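(* Let $X$ be a Banach space and suppose that the linear equation $v'=A(t)v$ admits a nonuniform exponential trichotomy, i.e. a generalized trichotomy with bounds $$\alpha_{t,s}=\begin{cases}D e^{a(t-s)+\varepsilon|s|}&\text{for } t\ge s,\\ D e^{c(s-t)+\varepsilon|s|}&\text{for } t\le s,\end{cases}\qquad \beta^+_{t,s}=De^{d(t-s)+\varepsilon|s|}\ \ (t\ge s),\qquad \beta^-_{t,s}=De^{b(s-t)+\varepsilon|s|}\ \ (t\le s),$$ where $a,b,c,d,D,\varepsilon\in\mathbb{R}$ with $D\ge1$, $\varepsilon\ge0$. Suppose that $f\colon\mathbb{R}\times X\to X$ is a continuous function such that $f(t,0)=0$ and $\operatorname{Lip}(f_t)<+\infty$ for every $t\in\mathbb{R}$, and $$\operatorname{Lip}(f_r)\le\frac{\delta}{D^2e^{2\varepsilon|r|}}\min\left\{-c-d-\varepsilon\operatorname{sgn}(r),\ -a-b+\varepsilon\operatorname{sgn}(r),\ \frac{D\gamma}{2}e^{(\varepsilon-\gamma)|r|}\right\}$$ for every $r\in\mathbb{R}\setminus\{0\}$, where $\delta<1/6$ and $$\gamma=\varepsilon\ \text{ if }\ \varepsilon>0\qquad\text{and}\qquad 0<\gamma<\frac{2}{D}\min\{-c-d,-a-b\}\ \text{ if }\ \varepsilon=0.$$ Assume $\omega>0$. If $$a+b+\varepsilon<0\qquad\text{and}\qquad c+d+\varepsilon<0,$$ then the equation $v'=A(t)v+f(t,v)$ admits a global Lipschitz invariant center manifold, i.e., there is $N\in(0,1)$ and a unique $\varphi\in\mathcal{A}_N$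 such that $\Psi_\tau(\mathcal{V}_\varphi)\subseteq\mathcal{V}_\varphi$ for every $\tau\in\mathbb{R}$ and $$\|\Psi_{t-s}(p_{s,\xi})-\Psi_{t-s}(p_{s,\bar\xi})\|\le\begin{cases}\dfrac{DN}{\omega}\,e^{a(t-s)+\varepsilon|s|}\,\|\xi-\bar\xi\|&\text{if } t\ge s,\\[3mm]\dfrac{DN}{\omega}\,e^{c(s-t)+\varepsilon|s|}\,\|\xi-\bar\xi\|&\text{if } t\le s,\end{cases}$$ for all $(s,\xi),(s,\bar\xi)\in G$, where $p_{s,\xi}=(s,\xi,\varphi(s,\xi))$ and $p_{s,\bar\xi}=(s,\bar\xi,\varphi(s,\bar\xi))$.
   Context: $X$ is a Banach space, $B(X)$ the Banach algebra of bounded linear operators on $X$, and $A\colon\mathbb{R}\to B(X)$ is continuous. $T_{t,s}$ ($t,s\in\mathbb{R}$) is the evolution operator of $v'=A(t)v$: every solution satisfies $v(t)=T_{t,s}v(s)$. Invariant splitting: for every $t\in\mathbb{R}$ there are bounded projections $P_t,Q^+_t,Q^-_t\in B(X)$ such that, for all $t,s\in\mathbb{R}$: $P_t+Q^+_t+Q^-_t=\mathrm{Id}$; $P_tQ^+_t=0$; $P_tT_{t,s}=T_{t,s}P_s$; $Q^+_tT_{t,s}=T_{t,s}Q^+_s$. Put $E_t=P_t(X)$, $F^+_t=Q^+_t(X)$, $F^-_t=Q^-_t(X)$; $E_t\times F^+_t\times F^-_t$ is identified with $E_t\oplus F^+_t\oplus F^-_t=X$. Generalized trichotomy: let $\mathbb{R}^2_{\ge}=\{(t,s)\in\mathbb{R}^2: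 t\ge s\}$, $\mathbb{R}^2_{\le}=\{(t,s)\in\mathbb{R}^2: t\le s\}$. Given positive functions $\alpha_{t,s}$ on $\mathbb{R}^2$, $\beta^+_{t,s}$ on $\mathbb{R}^2_\ge$, $\beta^-_{t,s}$ on $\mathbb{R}^2_\le$, the equation $v'=A(t)v$ admits a generalized trichotomy with these bounds if it admits an invariant splitting such that $\|T_{t,s}P_s\|\le\alpha_{t,s}$ for all $(t,s)\in\mathbb{R}^2$, $\|T_{t,s}Q^+_s\|\le\beta^+_{t,s}$ for all $(t,s)\in\mathbb{R}^2_\ge$, and $\|T_{t,s}Q^-_s\|\le\beta^-_{t,s}$ for all $(t,s)\in\mathbb{R}^2_\le$. For $f\colon\mathbb{R}\times X\to X$, $f_t(x)=f(t,x)$ and $\operatorname{Lip}(f_t)=\sup\{\|f(t,x)-f(t,y)\|/\|x-y\|: x,y\in X,\ x\ne y\}$. The constant $\omega$ is $$\omega:=\sup_{s\in\mathbb{R}}\left[\int_{-\infty}^s\beta^+_{s,r}\operatorname{Lip}(f_r)\,\alpha_{r,s}\,dr+\int_s^{+\infty}\beta^-_{s,r}\operatorname{Lip}(f_r)\,\alpha_{r,s}\,dr\right].$$ Flow: for $s\in\mathbb{R}$ and $v_s=(\xi,\eta^+,\eta^-)\in E_s\times F^+_s\times F^-_s$, let $(x(t,s,v_s),y^+(t,s,v_s),y^-(t,s,v_s))\in E_t\times F^+_t\times F^-_t$, $t\in\mathbb{R}$, be the only solution of $v'=A(t)v+f(t,v)$, $v(s)=v_s$. For $\tau\in\mathbb{R}$,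 $\Psi_\tau(s,v_s)=(s+\tau,x(s+\tau,s,v_s),y^+(s+\tau,s,v_s),y^-(s+\tau,s,v_s))\in\mathbb{R}\times X$. A difference of two points of $\mathbb{R}\times X$ with the same first coordinate is measured by the norm of $X$ of its second component. $G=\bigcup_{t\in\mathbb{R}}\{t\}\times E_t$. For $N>0$, $\mathcal{A}_N$ is the set of all continuous $\varphi\colon G\to X$ such that $\varphi(t,0)=0$ for all $t\in\mathbb{R}$; $\varphi(t,\xi)\in F^+_t\oplus F^-_t$ for all $(t,\xi)\in G$; and $\|\varphi(t,\xi)-\varphi(t,\bar\xi)\|\le N\|\xi-\bar\xi\|$ for all $(t,\xi),(t,\bar\xi)\in G$. The graph of $\varphi$ is $\mathcal{V}_\varphi=\{(s,\xi,\varphi(s,\xi)):(s,\xi)\in G\}\subseteq\mathbb{R}\times X$. *)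

theory Defs
  imports "HOL-Analysis.Analysis"
begin

definition ode_solution :: "(real \<Rightarrow> 'a::real_normed_vector \<Rightarrow> 'a) \<Rightarrow> (real \<Rightarrow> 'a) \<Rightarrow> bool" where
  "ode_solution g v \<longleftrightarrow> (\<forall>t. (v has_vector_derivative g t (v t)) (at t))"

definition evolution_operator ::
  "(real \<Rightarrow> 'a::real_normed_vector \<Rightarrow>\<^sub>L 'a) \<Rightarrow> (real \<Rightarrow> real \<Rightarrow> 'a \<Rightarrow>\<^sub>L 'a) \<Rightarrow> bool" where
  "evolution_operator A T \<longleftrightarrow>
    (\<forall>v. ode_solution (\<lambda>t. blinfun_apply (A t)) v \<longrightarrow> (\<forall>t s. v t = blinfun_apply (T t s) (v s)))"

definition invariant_splitting ::
  "(real \<Rightarrow> real \<Rightarrow> 'a::real_normed_vector \<Rightarrow>\<^sub>L 'a)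
    \<Rightarrow> (real \<Rightarrow> 'a \<Rightarrow>\<^sub>L 'a) \<Rightarrow> (real \<Rightarrow> 'a \<Rightarrow>\<^sub>L 'a) \<Rightarrow> (real \<Rightarrow> 'a \<Rightarrow>\<^sub>L 'a) \<Rightarrow> bool" where
  "invariant_splitting T P Qp Qm \<longleftrightarrow>
    (\<forall>t. P t o\<^sub>L P t = P t \<and> Qp t o\<^sub>L Qp t = Qp t \<and> Qm t o\<^sub>L Qm t = Qm t) \<and>
    (\<forall>t. P t + Qp t + Qm t = id_blinfun) \<and>
    (\<forall>t. P t o\<^sub>L Qp t = 0) \<and>
    (\<forall>t s. P t o\<^sub>L T t s = T t s o\<^sub>L P s) \<and>
    (\<forall>t s. Qp t o\<^sub>L T t s = T t s o\<^sub>L Qp s)"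

text \<open>The bounds \<open>\<beta>p\<close> and \<open>\<beta>m\<close> are only constrained on \<open>t \<ge> s\<close> and \<open>t \<le> s\<close>, respectively.\<close>

definition generalized_trichotomy ::
  "(real \<Rightarrow> real \<Rightarrow> 'a::real_normed_vector \<Rightarrow>\<^sub>L 'a)
    \<Rightarrow> (real \<Rightarrow> 'a \<Rightarrow>\<^sub>L 'a) \<Rightarrow> (real \<Rightarrow> 'a \<Rightarrow>\<^sub>L 'a) \<Rightarrow> (real \<Rightarrow> 'a \<Rightarrow>\<^sub>L 'a)
    \<Rightarrow> (real \<Rightarrow> real \<Rightarrow> real) \<Rightarrow> (real \<Rightarrow> real \<Rightarrow> real) \<Rightarrow> (real \<Rightarrow> real \<Rightarrow> real) \<Rightarrow> bool" where
  "generalized_trichotomy T P Qp Qm \<alpha> \<beta>p \<beta>m \<longleftrightarrow>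
    (\<forall>t s. \<alpha> t s > 0) \<and> (\<forall>t s. t \<ge> s \<longrightarrow> \<beta>p t s > 0) \<and> (\<forall>t s. t \<le> s \<longrightarrow> \<beta>m t s > 0) \<and>
    invariant_splitting T P Qp Qm \<and>
    (\<forall>t s. norm (T t s o\<^sub>L P s) \<le> \<alpha> t s) \<and>
    (\<forall>t s. t \<ge> s \<longrightarrow> norm (T t s o\<^sub>L Qp s) \<le> \<beta>p t s) \<and>
    (\<forall>t s. t \<le> s \<longrightarrow> norm (T t s o\<^sub>L Qm s) \<le> \<beta>m t s)"

definition exp_alpha :: "real \<Rightarrow> real \<Rightarrow> real \<Rightarrow> real \<Rightarrow> real \<Rightarrow> real \<Rightarrow> real" where
  "exp_alpha D a c \<epsilon> t s =
    (if t \<ge> s then D * exp (a * (t - s) + \<epsilon> * \<bar>s\<bar>) else D * exp (c * (s - t) + \<epsilon> * \<bar>s\<bar>))"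

definition exp_beta_plus :: "real \<Rightarrow> real \<Rightarrow> real \<Rightarrow> real \<Rightarrow> real \<Rightarrow> real" where
  "exp_beta_plus D d \<epsilon> t s = D * exp (d * (t - s) + \<epsilon> * \<bar>s\<bar>)"

definition exp_beta_minus :: "real \<Rightarrow> real \<Rightarrow> real \<Rightarrow> real \<Rightarrow> real \<Rightarrow> real" where
  "exp_beta_minus D b \<epsilon> t s = D * exp (b * (s - t) + \<epsilon> * \<bar>s\<bar>)"

definition nonuniform_exp_trichotomy ::
  "(real \<Rightarrow> real \<Rightarrow> 'a::real_normed_vector \<Rightarrow>\<^sub>L 'a)
    \<Rightarrow> (real \<Rightarrow> 'a \<Rightarrow>\<^sub>L 'a) \<Rightarrow> (real \<Rightarrow> 'a \<Rightarrow>\<^sub>L 'a) \<Rightarrow> (real \<Rightarrow> 'a \<Rightarrow>\<^sub>L 'a)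
    \<Rightarrow> real \<Rightarrow> real \<Rightarrow> real \<Rightarrow> real \<Rightarrow> real \<Rightarrow> real \<Rightarrow> bool" where
  "nonuniform_exp_trichotomy T P Qp Qm a b c d D \<epsilon> \<longleftrightarrow>
    generalized_trichotomy T P Qp Qm
      (exp_alpha D a c \<epsilon>) (exp_beta_plus D d \<epsilon>) (exp_beta_minus D b \<epsilon>)"

text \<open>
  The supremum is taken in the extended nonnegative reals, so it is \<open>\<infinity>\<close> for a non-Lipschitz
  map, and \<open>0\<close> on a one-point space.
\<close>

definition Lip :: "('a::real_normed_vector \<Rightarrow> 'a) \<Rightarrow> ennreal" where
  "Lip g = (SUP (x, y) \<in> {(x, y). x \<noteq> y}. ennreal (norm (g x - g y) / norm (x - y)))"

definition omega ::
  "(real \<Rightarrow> real \<Rightarrow> real) \<Rightarrow> (real \<Rightarrow> real \<Rightarrow> real) \<Rightarrow> (real \<Rightarrow> real \<Rightarrow> real)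
    \<Rightarrow> (real \<Rightarrow> 'a::real_normed_vector \<Rightarrow> 'a) \<Rightarrow> ennreal" where
  "omega \<alpha> \<beta>p \<beta>m f =
    (SUP s. (\<integral>\<^sup>+ r \<in> {..s}. ennreal (\<beta>p s r) * Lip (f r) * ennreal (\<alpha> r s) \<partial>lborel)
          + (\<integral>\<^sup>+ r \<in> {s..}. ennreal (\<beta>m s r) * Lip (f r) * ennreal (\<alpha> r s) \<partial>lborel))"

text \<open>
  Throughout, \<open>E\<^sub>t \<times> F\<^sup>+\<^sub>t \<times> F\<^sup>-\<^sub>t\<close> is identified with \<open>X\<close> by addition, so a
  triple \<open>(\<xi>, \<eta>\<^sup>+, \<eta>\<^sup>-)\<close> is the point \<open>\<xi> + \<eta>\<^sup>+ + \<eta>\<^sup>-\<close>.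
\<close>

definition perturbed_solution ::
  "(real \<Rightarrow> 'a::real_normed_vector \<Rightarrow>\<^sub>L 'a) \<Rightarrow> (real \<Rightarrow> 'a \<Rightarrow> 'a) \<Rightarrow> real \<Rightarrow> 'a \<Rightarrow> real \<Rightarrow> 'a" where
  "perturbed_solution A f s v =
    (THE u. ode_solution (\<lambda>t x. blinfun_apply (A t) x + f t x) u \<and> u s = v)"

definition Psi ::
  "(real \<Rightarrow> 'a::real_normed_vector \<Rightarrow>\<^sub>L 'a) \<Rightarrow> (real \<Rightarrow> 'a \<Rightarrow> 'a) \<Rightarrow> real \<Rightarrow> real \<times> 'a \<Rightarrow> real \<times> 'a" where
  "Psi A f \<tau> = (\<lambda>(s, v). (s + \<tau>, perturbed_solution A f s v (s + \<tau>)))"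

definition center_bundle :: "(real \<Rightarrow> 'a::real_normed_vector \<Rightarrow>\<^sub>L 'a) \<Rightarrow> (real \<times> 'a) set" where
  "center_bundle P = {(t, \<xi>). \<xi> \<in> range (blinfun_apply (P t))}"

text \<open>
  Maps on the center bundle are represented by total functions with the fixed value
  \<open>undefined\<close> elsewhere (\<^const>\<open>extensional\<close>), so that equality is equality on the bundle.
\<close>

definition graph_maps ::
  "(real \<Rightarrow> 'a::real_normed_vector \<Rightarrow>\<^sub>L 'a) \<Rightarrow> (real \<Rightarrow> 'a \<Rightarrow>\<^sub>L 'a) \<Rightarrow> (real \<Rightarrow> 'a \<Rightarrow>\<^sub>L 'a)
    \<Rightarrow> real \<Rightarrow> (real \<times> 'a \<Rightarrow> 'a) set" where
  "graph_maps P Qp Qm N = {\<phi> \<in> extensional (center_bundle P).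
    continuous_on (center_bundle P) \<phi> \<and>
    (\<forall>t. \<phi> (t, 0) = 0) \<and>
    (\<forall>(t, \<xi>) \<in> center_bundle P.
      \<exists>u \<in> range (blinfun_apply (Qp t)). \<exists>w \<in> range (blinfun_apply (Qm t)). \<phi> (t, \<xi>) = u + w) \<and>
    (\<forall>t \<xi> \<xi>'. (t, \<xi>) \<in> center_bundle P \<longrightarrow> (t, \<xi>') \<in> center_bundle P \<longrightarrow>
      norm (\<phi> (t, \<xi>) - \<phi> (t, \<xi>')) \<le> N * norm (\<xi> - \<xi>'))}"

definition graph_point :: "(real \<times> 'a::real_normed_vector \<Rightarrow> 'a) \<Rightarrow> real \<Rightarrow> 'a \<Rightarrow> real \<times> 'a" where
  "graph_point \<phi> s \<xi> = (s, \<xi> + \<phi> (s, \<xi>))"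

definition bundle_graph ::
  "(real \<Rightarrow> 'a::real_normed_vector \<Rightarrow>\<^sub>L 'a) \<Rightarrow> (real \<times> 'a \<Rightarrow> 'a) \<Rightarrow> (real \<times> 'a) set" where
  "bundle_graph P \<phi> = {graph_point \<phi> s \<xi> |s \<xi>. (s, \<xi>) \<in> center_bundle P}"

end

theory Submission
  imports Defs
begin

text \<open>
  The center manifold is the graph of a fixed point of a graph transform. Given a map \<open>\<phi>\<close>
  on the center bundle with Lipschitz constant \<open>N\<close>, the central component of the flow restricted to
  the graph of \<open>\<phi>\<close> is a closed equation on the bundle \<open>E\<close>; let \<open>x\<close> be its trajectory through
  \<open>(s, \<xi>)\<close> and \<open>h(r) = f(r, x(r) + \<phi>(r, x(r)))\<close>. The complementary component driven by \<open>h\<close> has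
  exactly one solution \<open>y\<close> whose stable part has no memory of \<open>-\<infinity>\<close> and whose unstable part has no
  memory of \<open>+\<infinity>\<close>, and the transform of \<open>\<phi>\<close> takes the value \<open>y(s)\<close> at \<open>(s, \<xi>)\<close>. The graph of
  \<open>\<phi>\<close> is invariant if and only if \<open>\<phi>\<close> is fixed by the transform: for a fixed point \<open>x + y\<close>
  solves the full equation and \<open>y(t) = \<phi>(t, x(t))\<close>; conversely along an invariant graph
  \<open>\<phi>(t, x(t))\<close> is of size \<open>\<parallel>x(t)\<parallel>\<close>, and the gaps \<open>a + b + \<epsilon> < 0\<close> and \<open>c + d + \<epsilon> < 0\<close> force the
  memory terms to vanish (\<open>fixed_map_invariant\<close>, \<open>invariant_map_fixed\<close>).

  The bound on \<open>Lip(f\<^sub>r)\<close> enters through three one-dimensional integrals. Each of them has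
  an explicit primitive, and each is at most \<open>\<delta>\<close>: one for the central equation, relative to the
  weight \<open>\<alpha>\<close>, and one for each of the two complementary directions, which also gives
  \<open>\<omega> \<le> 2\<delta>\<close>. With \<open>N = 6\<delta> < 1\<close> the map \<open>\<xi> \<mapsto> \<xi> + \<phi>(t, \<xi>)\<close> has Lipschitz
  constant at most \<open>2\<close>, so trajectories on the center bundle satisfy
  \<open>\<parallel>x(t) - x'(t)\<parallel> \<le> M \<alpha>\<^sub>t\<^sub>,\<^sub>s \<parallel>\<xi> - \<xi>'\<parallel>\<close> with \<open>M = 1 / (1 - 2/6) = 3/2\<close>
  (\<open>center_trajectory_estimate\<close>). Hence the transform preserves the Lipschitz constant,
  \<open>2\<delta> \<cdot> 2 \<cdot> 3/2 = 6\<delta>\<close> (\<open>graph_transform_lipschitz\<close>), it contracts the distance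
  \<open>sup \<parallel>\<phi>(t, \<xi>) - \<psi>(t, \<xi>)\<parallel> / \<parallel>\<xi>\<parallel>\<close> by \<open>2\<delta> \<cdot> (3/2)\<^sup>2 \<le> 3/4\<close>
  (\<open>graph_transform_contraction\<close>), and points of the invariant graph separate by at most
  \<open>2 \<cdot> 3/2 \<cdot> \<alpha>\<^sub>t\<^sub>,\<^sub>s = 3 \<alpha>\<^sub>t\<^sub>,\<^sub>s \<le> (N/\<omega>) \<alpha>\<^sub>t\<^sub>,\<^sub>s\<close>.

  Two devices keep the analysis elementary. In the moving frame \<open>T\<^sub>0\<^sub>,\<^sub>t v(t)\<close> the linear part of
  the equation disappears, so variation of constants becomes the fundamental theorem of calculus
  with the constant projections at time \<open>0\<close>. And every integral estimate is stated as a comparison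
  of the increment of a vector-valued function with that of a real primitive
  (\<open>norm_increment_le\<close>); improper integrals turn into limits of primitives.
\<close>

section \<open>Increments, limits and primitives\<close>

text \<open>A mean value inequality that tolerates a kink at \<open>0\<close>: the primitives used below involve
  \<open>\<bar>r\<bar>\<close>, because the bounds of a nonuniform trichotomy depend on \<open>e\<^bsup>\<epsilon>\<bar>s\<bar>\<^esup>\<close>.\<close>

lemma norm_increment_le:
  fixes G :: "real \<Rightarrow> 'b::real_normed_vector"
  assumes "u \<le> v"
    and cG: "continuous_on {u..v} G" and cF: "continuous_on {u..v} F"
    and dG: "\<And>r. u < r \<Longrightarrow> r < v \<Longrightarrow> r \<noteq> 0 \<Longrightarrow> (G has_vector_derivative G' r) (at r)"
    and dF: "\<And>r. u < r \<Longrightarrow> r < v \<Longrightarrow> r \<noteq> 0 \<Longrightarrow> (F has_vector_derivative F' r) (at r)"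
    and le: "\<And>r. u < r \<Longrightarrow> r < v \<Longrightarrow> r \<noteq> 0 \<Longrightarrow> norm (G' r) \<le> F' r"
  shows "norm (G v - G u) \<le> F v - F u"
proof -
  have *: "norm (G y - G x) \<le> F y - F x"
    if "u \<le> x" "x \<le> y" "y \<le> v" "0 \<notin> {x<..<y}" for x y
  proof (cases "x = y")
    case False
    show ?thesis
    proof (rule differentiable_bound_general[of x y G F G' F'])
      show "continuous_on {x..y} G" "continuous_on {x..y} F"
        using that by (auto intro: continuous_on_subset[OF cG] continuous_on_subset[OF cF])
    qed (use that False in \<open>auto intro!: dG dF le\<close>)
  qed simp
  show ?thesis
  proof (cases "0 \<in> {u<..<v}")
    case True
    have "norm (G v - G u) \<le> norm (G v - G 0) + norm (G 0 - G u)"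
      using norm_triangle_ineq[of "G v - G 0" "G 0 - G u"] by simp
    also have "\<dots> \<le> (F v - F 0) + (F 0 - F u)"
      using True by (intro add_mono *) auto
    finally show ?thesis by simp
  qed (use * \<open>u \<le> v\<close> in auto)
qed

text \<open>The closed segment covers both time directions at once; the absolute value absorbs the
  orientation.\<close>

lemma norm_increment_segment:
  fixes G :: "real \<Rightarrow> 'b::real_normed_vector"
  assumes dG: "\<And>r. (G has_vector_derivative G' r) (at r)"
    and dF: "\<And>r. r \<in> closed_segment s t \<Longrightarrow> r \<noteq> 0 \<Longrightarrow> (F has_vector_derivative F' r) (at r)"
    and cF: "continuous_on (closed_segment s t) F"
    and le: "\<And>r. r \<in> closed_segment s t \<Longrightarrow> r \<noteq> 0 \<Longrightarrow> norm (G' r) \<le> F' r"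
  shows "norm (G t - G s) \<le> \<bar>F t - F s\<bar>"
proof -
  have cG: "continuous_on X G" for X
    using dG by (meson continuous_at_imp_continuous_on has_vector_derivative_continuous)
  show ?thesis
  proof (cases "s \<le> t")
    case True
    then have "norm (G t - G s) \<le> F t - F s"
      by (intro norm_increment_le[where G' = G' and F' = F'] cG)
        (use assms in \<open>auto simp: closed_segment_eq_real_ivl\<close>)
    then show ?thesis by simp
  next
    case False
    then have "norm (G s - G t) \<le> F s - F t"
      by (intro norm_increment_le[where G' = G' and F' = F'] cG)
        (use assms in \<open>auto simp: closed_segment_eq_real_ivl\<close>)
    then show ?thesis by (simp add: norm_minus_commute)
  qed
qed

lemma norm_increment_le_bound:
  fixes G :: "real \<Rightarrow> 'b::real_normed_vector"
  assumes "\<And>r. (G has_vector_derivative G' r) (at r)" "C \<ge> 0"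
    and "\<And>r. r \<in> closed_segment s t \<Longrightarrow> norm (G' r) \<le> C"
  shows "norm (G t - G s) \<le> C * \<bar>t - s\<bar>"
proof -
  have "norm (G t - G s) \<le> \<bar>C * t - C * s\<bar>"
    using assms
    by (intro norm_increment_segment[where G' = G' and F' = "\<lambda>_. C"])
      (auto intro!: continuous_intros derivative_eq_intros
        simp flip: has_real_derivative_iff_has_vector_derivative)
  then show ?thesis using \<open>C \<ge> 0\<close> by (simp add: abs_mult flip: right_diff_distrib)
qed

text \<open>The Cauchy criterion for an improper integral, with \<open>F\<close> a primitive of an integrable
  majorant.\<close>

lemma limit_at_bot_if_dominated:
  fixes G :: "real \<Rightarrow> 'b::banach"
  assumes dom: "\<And>u v. u \<le> v \<Longrightarrow> v \<le> s \<Longrightarrow> norm (G v - G u) \<le> F v - F u"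
    and F: "(F \<longlongrightarrow> l) at_bot"
  shows "\<exists>L. (G \<longlongrightarrow> L) at_bot"
proof -
  have small: "\<exists>k. \<forall>u v. u \<le> k \<longrightarrow> v \<le> k \<longrightarrow> dist (G u) (G v) < e" if "e > 0" for e :: real
  proof -
    have "eventually (\<lambda>r. dist (F r) l < e / 2) at_bot"
      using F that by (intro tendstoD) auto
    then obtain k where k: "\<And>r. r \<le> k \<Longrightarrow> dist (F r) l < e / 2"
      unfolding eventually_at_bot_linorder by blast
    have *: "dist (G u) (G v) < e" if "u \<le> v" "v \<le> min k s" for u v
      using dom[of u v] k[of u] k[of v] that
      by (auto simp: dist_norm norm_minus_commute abs_if split: if_splits)
    show ?thesis
      by (intro exI[of _ "min k s"]) (metis * dist_commute linear)
  qed
  have "Cauchy (\<lambda>n. G (- real n))"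
  proof (rule metric_CauchyI)
    fix e :: real assume "e > 0"
    then obtain k where k: "\<And>u v. u \<le> k \<Longrightarrow> v \<le> k \<Longrightarrow> dist (G u) (G v) < e"
      using small by blast
    obtain M where "- k \<le> real M" using real_arch_simple by blast
    then show "\<exists>M. \<forall>m\<ge>M. \<forall>n\<ge>M. dist (G (- real m)) (G (- real n)) < e"
      by (intro exI[of _ M] allI impI k) auto
  qed
  then obtain L where L: "(\<lambda>n. G (- real n)) \<longlonglongrightarrow> L"
    using Cauchy_convergent convergent_def by blast
  have "(G \<longlongrightarrow> L) at_bot"
  proof (rule tendstoI)
    fix e :: real assume "e > 0"
    then obtain k where k: "\<And>u v. u \<le> k \<Longrightarrow> v \<le> k \<Longrightarrow> dist (G u) (G v) < e / 2"
      using small[of "e / 2"] by auto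
    have "eventually (\<lambda>n. dist (G (- real n)) L < e / 2) sequentially"
      using L \<open>e > 0\<close> by (intro tendstoD) auto
    moreover obtain M where "- k \<le> real M" using real_arch_simple by blast
    then have "eventually (\<lambda>n. - real n \<le> k) sequentially"
      by (intro eventually_sequentiallyI[of M]) auto
    ultimately have "eventually (\<lambda>n. dist (G (- real n)) L < e / 2 \<and> - real n \<le> k) sequentially"
      by eventually_elim simp
    then obtain n where n: "dist (G (- real n)) L < e / 2" "- real n \<le> k"
      using eventually_happens'[OF sequentially_bot] by blast
    have "dist (G r) L < e" if "r \<le> k" for r
      using k[OF that n(2)] n(1) dist_triangle[of "G r" L "G (- real n)"] by simp
    then show "eventually (\<lambda>r. dist (G r) L < e) at_bot"
      unfolding eventually_at_bot_linorder by blast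
  qed
  then show ?thesis by blast
qed

lemma limit_at_top_if_dominated:
  fixes G :: "real \<Rightarrow> 'b::banach"
  assumes dom: "\<And>u v. s \<le> u \<Longrightarrow> u \<le> v \<Longrightarrow> norm (G v - G u) \<le> F v - F u"
    and F: "(F \<longlongrightarrow> l) at_top"
  shows "\<exists>L. (G \<longlongrightarrow> L) at_top"
proof -
  have "\<exists>L. ((\<lambda>r. G (- r)) \<longlongrightarrow> L) at_bot"
  proof (rule limit_at_bot_if_dominated)
    show "norm (G (- v) - G (- u)) \<le> - F (- v) - - F (- u)" if "u \<le> v" "v \<le> - s" for u v
      using dom[of "- v" "- u"] that by (simp add: norm_minus_commute)
    show "((\<lambda>r. - F (- r)) \<longlongrightarrow> - l) at_bot"
      using F unfolding filterlim_at_top_mirror by (intro tendsto_minus)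
  qed
  then show ?thesis by (simp add: filterlim_at_top_mirror)
qed

text \<open>The increasing intervals exhaust a half-line; each integral over one of them is the increment
  of \<open>F\<close>, by the fundamental theorem of calculus with the exceptional point \<open>0\<close>.\<close>

lemma nn_integral_le_increment:
  fixes F F' :: "real \<Rightarrow> real"
  assumes cF: "continuous_on UNIV F"
    and dF: "\<And>r. r \<noteq> 0 \<Longrightarrow> (F has_vector_derivative F' r) (at r)"
    and F': "\<And>r. F' r \<ge> 0" "F' \<in> borel_measurable borel"
    and le: "\<And>n. u n \<le> v n" and inc: "incseq (\<lambda>n. {u n..v n})"
    and bound: "\<And>n. F (v n) - F (u n) \<le> K"
  shows "(\<integral>\<^sup>+ r \<in> (\<Union>n. {u n..v n}). ennreal (F' r) \<partial>lborel) \<le> ennreal K"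
proof -
  let ?M = "density lborel (\<lambda>r. ennreal (F' r))"
  have meas: "(\<lambda>r. ennreal (F' r)) \<in> borel_measurable lborel" using F'(2) by simp
  have "emeasure ?M {u n..v n} \<le> ennreal K" for n
  proof -
    have "(F' has_integral (F (v n) - F (u n))) {u n..v n}"
      by (rule fundamental_theorem_of_calculus_interior_strong[of "{0}"])
        (use le dF in \<open>auto intro: continuous_on_subset[OF cF]\<close>)
    then have "(\<integral>\<^sup>+ r. ennreal (F' r) * indicator {u n..v n} r \<partial>lborel) = ennreal (F (v n) - F (u n))"
      by (intro nn_integral_has_integral_lebesgue' F')
    then show ?thesis
      using bound[of n] by (simp add: emeasure_density[OF meas] ennreal_leI)
  qed
  then have "emeasure ?M (\<Union>n. {u n..v n}) \<le> ennreal K"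
    by (subst SUP_emeasure_incseq[symmetric, OF _ inc]) (auto intro: SUP_least)
  then show ?thesis by (simp add: emeasure_density[OF meas])
qed

text \<open>For either sign of \<open>t\<close> at most one of the two intervals is nondegenerate, so this is the
  oriented integral from \<open>0\<close> to \<open>t\<close>.\<close>

definition antiderivative :: "(real \<Rightarrow> 'b::banach) \<Rightarrow> real \<Rightarrow> 'b" where
  "antiderivative g t = integral {0..t} g - integral {t..0} g"

lemma antiderivative_has_derivative:
  fixes g :: "real \<Rightarrow> 'b::banach"
  assumes "continuous_on UNIV g"
  shows "(antiderivative g has_vector_derivative g t) (at t)"
proof -
  define n where "n = \<bar>t\<bar> + 1"
  have cont: "continuous_on X g" for X
    using assms continuous_on_subset by blast
  have eq: "antiderivative g r = integral {-n..r} g - integral {-n..0} g"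
    if "r \<in> {-n<..<n}" for r
  proof (cases "0 \<le> r")
    case True
    then have "integral {-n..0} g + integral {0..r} g = integral {-n..r} g"
      using that by (intro Henstock_Kurzweil_Integration.integral_combine
          integrable_continuous_interval cont) (auto simp: n_def)
    moreover have "integral {r..0} g = 0"
      using True by (cases "r = 0") auto
    ultimately show ?thesis by (simp add: antiderivative_def algebra_simps)
  next
    case False
    then have "integral {-n..r} g + integral {r..0} g = integral {-n..0} g"
      using that by (intro Henstock_Kurzweil_Integration.integral_combine
          integrable_continuous_interval cont) (auto simp: n_def)
    then show ?thesis using False by (simp add: antiderivative_def algebra_simps)
  qed
  have "((\<lambda>r. integral {-n..r} g) has_vector_derivative g t) (at t within {-n..n})"
    by (rule integral_has_vector_derivative[OF cont]) (auto simp: n_def)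
  then have "((\<lambda>r. integral {-n..r} g) has_vector_derivative g t) (at t within {-n<..<n})"
    by (rule has_vector_derivative_within_subset) auto
  then have "((\<lambda>r. integral {-n..r} g) has_vector_derivative g t) (at t)"
    by (subst (asm) has_vector_derivative_within_open) (auto simp: n_def)
  then have "((\<lambda>r. integral {-n..r} g - integral {-n..0} g) has_vector_derivative g t) (at t)"
    by (auto intro!: derivative_eq_intros)
  then show ?thesis
    by (rule has_vector_derivative_transform_within_open[of _ _ _ "{-n<..<n}"])
      (auto simp: n_def eq)
qed

lemma constant_if_zero_derivative:
  fixes G :: "real \<Rightarrow> 'b::real_normed_vector"
  assumes "\<And>r. (G has_vector_derivative 0) (at r)"
  shows "G t = G s"
  using norm_increment_segment[of G "\<lambda>_. 0" s t "\<lambda>_. 0" "\<lambda>_. 0"] assms by auto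

section \<open>Global solutions of Lipschitz equations\<close>

text \<open>The weight of the Bielecki norm: against it, integrating \<open>L\<close> from \<open>s\<close> gains the factor
  \<open>1/2\<close>, so that the Picard operator is a contraction on the whole line.\<close>

definition ode_weight :: "(real \<Rightarrow> real) \<Rightarrow> real \<Rightarrow> real \<Rightarrow> real" where
  "ode_weight L s t = exp (2 * \<bar>antiderivative L t - antiderivative L s\<bar>)"

lemma ode_weight_ge_1: "ode_weight L s t \<ge> 1"
  by (simp add: ode_weight_def)

lemma continuous_ode_weight:
  assumes "continuous_on UNIV L"
  shows "continuous_on X (ode_weight L s)"
proof -
  have "continuous_on X (antiderivative L)"
    using antiderivative_has_derivative[OF assms]
    by (meson continuous_at_imp_continuous_on has_vector_derivative_continuous)
  then show ?thesis
    unfolding ode_weight_def by (intro continuous_intros)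
qed

text \<open>The gain of \<open>1/2\<close> comes from \<open>\<integral> L e\<^bsup>2\<Lambda>\<^esup> = e\<^bsup>2\<Lambda>\<^esup> / 2\<close>, where \<open>\<Lambda>\<close> is the integral of
  \<open>L\<close> from \<open>s\<close>.\<close>

lemma increment_le_ode_weight:
  fixes G :: "real \<Rightarrow> 'b::real_normed_vector"
  assumes L: "continuous_on UNIV L" "\<And>r. L r \<ge> 0" and "C \<ge> 0"
    and dG: "\<And>r. (G has_vector_derivative G' r) (at r)"
    and le: "\<And>r. r \<in> closed_segment s t \<Longrightarrow> norm (G' r) \<le> C * L r * ode_weight L s r"
  shows "norm (G t - G s) \<le> C / 2 * (ode_weight L s t - 1)"
proof -
  let ?I = "antiderivative L"
  \<comment> \<open>\<open>\<sigma>\<close> is the direction of time; on the segment it removes the absolute value in the weight.\<close>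
  define \<sigma> :: real where "\<sigma> = (if s \<le> t then 1 else -1)"
  have dI: "(?I has_real_derivative L r) (at r)" for r
    using antiderivative_has_derivative[OF L(1)]
    by (simp add: has_real_derivative_iff_has_vector_derivative)
  have mono: "?I x \<le> ?I y" if "x \<le> y" for x y
    using that dI L(2) by (intro DERIV_nonneg_imp_nondecreasing[of x y ?I]) auto
  have w: "ode_weight L s r = exp (2 * \<sigma> * (?I r - ?I s))" if "r \<in> closed_segment s t" for r
    using that mono[of s r] mono[of r s]
    by (auto simp: ode_weight_def \<sigma>_def closed_segment_eq_real_ivl split: if_splits)
  define F where "F r = \<sigma> * C / 2 * exp (2 * \<sigma> * (?I r - ?I s))" for r
  have sq: "\<sigma> * \<sigma> = 1" by (simp add: \<sigma>_def)
  have dF: "(F has_real_derivative C * L r * exp (2 * \<sigma> * (?I r - ?I s))) (at r)" for r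
    unfolding F_def
    by (rule derivative_eq_intros dI refl | simp)+ (use sq in algebra)
  have "norm (G t - G s) \<le> \<bar>F t - F s\<bar>"
  proof (rule norm_increment_segment[OF dG])
    show "(F has_vector_derivative C * L r * exp (2 * \<sigma> * (?I r - ?I s))) (at r)" for r
      using dF by (simp add: has_real_derivative_iff_has_vector_derivative)
    show "continuous_on (closed_segment s t) F"
      using dF by (meson DERIV_isCont continuous_at_imp_continuous_on)
    show "norm (G' r) \<le> C * L r * exp (2 * \<sigma> * (?I r - ?I s))" if "r \<in> closed_segment s t" for r
      using le[OF that] w[OF that] by simp
  qed
  also have "F t - F s = \<sigma> * (C / 2 * (ode_weight L s t - 1))"
    by (simp add: F_def w algebra_simps)
  also have "\<bar>\<dots>\<bar> = C / 2 * (ode_weight L s t - 1)"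
    using ode_weight_ge_1[of L s t] \<open>C \<ge> 0\<close> by (simp add: \<sigma>_def abs_mult)
  finally show ?thesis .
qed

text \<open>At a maximum \<open>e\<close> of the weighted difference over the segment from \<open>s\<close> to \<open>t\<close>, the gain of
  the weight yields \<open>e \<le> e/2\<close>.\<close>

lemma ode_solution_unique:
  fixes F :: "real \<Rightarrow> 'b::real_normed_vector \<Rightarrow> 'b"
  assumes L: "continuous_on UNIV L"
    and lip: "\<And>t x y. norm (F t x - F t y) \<le> L t * norm (x - y)" "\<And>t. L t \<ge> 0"
    and sol: "ode_solution F u" "ode_solution F w" "u s = w s"
  shows "u = w"
proof
  fix t
  let ?w = "ode_weight L s" and ?S = "closed_segment s t"
  have cont: "continuous_on X u" "continuous_on X w" for X
    using sol by (meson continuous_at_imp_continuous_on has_vector_derivative_continuous ode_solution_def)+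
  define e where "e r = norm (u r - w r) / ?w r" for r
  have wpos: "?w r > 0" for r
    using ode_weight_ge_1[of L s r] by linarith
  have "continuous_on ?S e"
    unfolding e_def using wpos
    by (intro continuous_intros cont continuous_ode_weight L) (auto simp: less_imp_neq[symmetric])
  then obtain m where m: "m \<in> ?S" "\<And>r. r \<in> ?S \<Longrightarrow> e r \<le> e m"
    using continuous_attains_sup[of ?S e] compact_segment by auto
  have sub: "closed_segment s m \<subseteq> ?S"
    using m(1) by (simp add: closed_segment_subset)
  have "e m \<ge> 0" using wpos[of m] by (simp add: e_def)
  have "norm ((u m - w m) - (u s - w s)) \<le> e m / 2 * (?w m - 1)"
  proof (rule increment_le_ode_weight[OF L lip(2) \<open>e m \<ge> 0\<close>])
    show "((\<lambda>r. u r - w r) has_vector_derivative F r (u r) - F r (w r)) (at r)" for r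
      using sol by (intro has_vector_derivative_diff) (auto simp: ode_solution_def)
    show "norm (F r (u r) - F r (w r)) \<le> e m * L r * ?w r" if "r \<in> closed_segment s m" for r
    proof -
      have "norm (u r - w r) = e r * ?w r" using wpos[of r] by (simp add: e_def)
      also have "\<dots> \<le> e m * ?w r" using m(2)[of r] that sub wpos[of r] by auto
      finally show ?thesis
        using lip(1)[of r "u r" "w r"] lip(2)[of r]
        by (smt (verit) mult.commute mult.left_commute mult_left_mono)
    qed
  qed
  then have "e m * ?w m \<le> e m / 2 * (?w m - 1)"
    using sol(3) wpos[of m] by (simp add: e_def)
  moreover have "e m * ?w m \<ge> e m * 1"
    using ode_weight_ge_1[of L s m] \<open>e m \<ge> 0\<close> by (rule mult_left_mono)
  ultimately have "e m = 0" using \<open>e m \<ge> 0\<close> by (auto simp: algebra_simps)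
  then have "e t \<le> 0" using m(2)[of t] by auto
  then have "norm (u t - w t) \<le> 0"
    using wpos[of t] by (auto simp: e_def divide_le_0_iff)
  then show "u t = w t" by simp
qed

text \<open>The Picard operator \<open>\<Theta>\<close>, conjugated by the weight to \<open>\<Phi>\<close>, acts on bounded continuous
  functions: since \<open>F\<close> vanishes at \<open>0\<close>, the contraction estimate against the zero function also
  shows that \<open>\<Phi>\<close> maps into bounded functions.\<close>

lemma ode_solution_exists:
  fixes F :: "real \<Rightarrow> 'b::banach \<Rightarrow> 'b"
  assumes F: "continuous_on UNIV (\<lambda>(t, x). F t x)" "\<And>t. F t 0 = 0"
    and L: "continuous_on UNIV L"
    and lip: "\<And>t x y. norm (F t x - F t y) \<le> L t * norm (x - y)" "\<And>t. L t \<ge> 0"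
  shows "\<exists>u. ode_solution F u \<and> u s = v"
proof -
  let ?w = "ode_weight L s"
  define g where "g u r = F r (?w r *\<^sub>R apply_bcontfun u r)" for u :: "real \<Rightarrow>\<^sub>C 'b" and r
  define \<Theta> where "\<Theta> u t = v + (antiderivative (g u) t - antiderivative (g u) s)" for u t
  have wpos: "?w r > 0" for r
    using ode_weight_ge_1[of L s r] by linarith
  have cg: "continuous_on UNIV (g u)" for u
  proof -
    have "continuous_on UNIV ((\<lambda>(t, x). F t x) \<circ> (\<lambda>r. (r, ?w r *\<^sub>R apply_bcontfun u r)))"
      by (intro continuous_on_compose continuous_intros continuous_ode_weight L
          continuous_on_subset[OF F(1)]) auto
    then show ?thesis by (simp add: g_def o_def)
  qed
  have d\<Theta>: "(\<Theta> u has_vector_derivative g u t) (at t)" for u t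
    unfolding \<Theta>_def by (auto intro!: derivative_eq_intros antiderivative_has_derivative[OF cg])
  have c\<Theta>: "continuous_on UNIV (\<Theta> u)" for u
    using d\<Theta> by (meson continuous_at_imp_continuous_on has_vector_derivative_continuous)
  have diff: "norm (\<Theta> u t - \<Theta> u' t) \<le> dist u u' / 2 * (?w t - 1)" for u u' t
  proof -
    have "norm ((\<Theta> u t - \<Theta> u' t) - (\<Theta> u s - \<Theta> u' s)) \<le> dist u u' / 2 * (?w t - 1)"
    proof (rule increment_le_ode_weight[OF L lip(2) zero_le_dist])
      show "((\<lambda>r. \<Theta> u r - \<Theta> u' r) has_vector_derivative g u r - g u' r) (at r)" for r
        by (intro has_vector_derivative_diff d\<Theta>)
      show "norm (g u r - g u' r) \<le> dist u u' * L r * ?w r" for r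
      proof -
        have "norm (g u r - g u' r) \<le> L r * norm (?w r *\<^sub>R u r - ?w r *\<^sub>R u' r)"
          unfolding g_def by (rule lip)
        also have "\<dots> = L r * (?w r * dist (u r) (u' r))"
          using wpos[of r] by (simp add: dist_norm flip: scaleR_diff_right)
        also have "\<dots> \<le> L r * (?w r * dist u u')"
          using lip(2)[of r] wpos[of r] by (intro mult_left_mono dist_bounded) auto
        finally show ?thesis by (simp add: mult_ac)
      qed
    qed
    then show ?thesis by (simp add: \<Theta>_def)
  qed
  have \<Theta>0: "\<Theta> 0 t = v" for t
    using constant_if_zero_derivative[of "\<Theta> 0" t s] d\<Theta>[of 0] by (simp add: g_def F(2) \<Theta>_def)
  define \<Phi> where "\<Phi> u t = (1 / ?w t) *\<^sub>R \<Theta> u t" for u t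
  have bc: "\<Phi> u \<in> bcontfun" for u
  proof (rule bcontfun_normI)
    show "continuous_on UNIV (\<Phi> u)"
      unfolding \<Phi>_def using wpos
      by (intro continuous_intros c\<Theta> continuous_ode_weight L) (auto simp: less_imp_neq[symmetric])
    fix t
    have "norm (\<Theta> u t) \<le> norm v + dist u 0 / 2 * (?w t - 1)"
      using norm_triangle_ineq[of "\<Theta> 0 t" "\<Theta> u t - \<Theta> 0 t"] diff[of u t 0] by (simp add: \<Theta>0)
    also have "\<dots> \<le> norm v * ?w t + dist u 0 / 2 * ?w t"
      using ode_weight_ge_1[of L s t] mult_left_mono[of 1 "?w t" "norm v"]
      by (intro add_mono mult_left_mono) auto
    finally show "norm (\<Phi> u t) \<le> norm v + dist u 0 / 2"
      using wpos[of t] by (simp add: \<Phi>_def field_simps)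
  qed
  have "\<exists>!u. Bcontfun (\<Phi> u) = u"
  proof (rule banach_fix_type[of "1/2"]; safe?)
    fix u u' :: "real \<Rightarrow>\<^sub>C 'b"
    show "dist (Bcontfun (\<Phi> u)) (Bcontfun (\<Phi> u')) \<le> 1 / 2 * dist u u'"
    proof (rule dist_bound)
      fix t
      have "dist (\<Phi> u t) (\<Phi> u' t) = norm (\<Theta> u t - \<Theta> u' t) / ?w t"
        using wpos[of t] by (simp add: \<Phi>_def dist_norm flip: scaleR_diff_right)
      also have "\<dots> \<le> (dist u u' / 2 * ?w t) / ?w t"
        using diff[of u t u'] wpos[of t] mult_left_mono[of "?w t - 1" "?w t" "dist u u' / 2"]
        by (intro divide_right_mono) auto
      finally show "dist (apply_bcontfun (Bcontfun (\<Phi> u)) t) (apply_bcontfun (Bcontfun (\<Phi> u')) t)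
          \<le> 1 / 2 * dist u u'"
        using wpos[of t] by (simp add: Bcontfun_inverse bc less_imp_neq[symmetric])
    qed
  qed auto
  then obtain u where u: "Bcontfun (\<Phi> u) = u" by blast
  then have "apply_bcontfun u t = \<Phi> u t" for t
    by (metis Bcontfun_inverse bc)
  then have "g u t = F t (\<Theta> u t)" for t
    using wpos[of t] by (simp add: g_def \<Phi>_def)
  then have "ode_solution F (\<Theta> u)"
    using d\<Theta>[of u] by (simp add: ode_solution_def)
  moreover have "\<Theta> u s = v" by (simp add: \<Theta>_def)
  ultimately show ?thesis by blast
qed

section \<open>The linear evolution in operator norm\<close>

locale linear_evolution =
  fixes A :: "real \<Rightarrow> 'a::banach \<Rightarrow>\<^sub>L 'a" and T :: "real \<Rightarrow> real \<Rightarrow> 'a \<Rightarrow>\<^sub>L 'a"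
  assumes continuous_A: "continuous_on UNIV A"
    and evolution: "evolution_operator A T"
begin

lemma continuous_norm_A: "continuous_on UNIV (\<lambda>t. norm (A t))"
  by (intro continuous_on_norm continuous_A)

lemma linear_solution_exists: "\<exists>v. ode_solution (\<lambda>t. blinfun_apply (A t)) v \<and> v s = w"
proof (rule ode_solution_exists[OF _ _ continuous_norm_A])
  show "continuous_on UNIV (\<lambda>(t, x). blinfun_apply (A t) x)"
    unfolding split_beta
    by (intro blinfun.continuous_on continuous_on_compose2[OF continuous_A] continuous_intros) auto
  show "norm (blinfun_apply (A t) x - blinfun_apply (A t) y) \<le> norm (A t) * norm (x - y)" for t x y
    by (metis blinfun.diff_right norm_blinfun)
qed auto

lemma T_solution:
  "ode_solution (\<lambda>t. blinfun_apply (A t)) (\<lambda>t. T t s w)" and T_refl: "T s s w = w"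
proof -
  obtain v where v: "ode_solution (\<lambda>t. blinfun_apply (A t)) v" "v s = w"
    using linear_solution_exists by blast
  have eq: "v = (\<lambda>t. T t s w)"
    using evolution v unfolding evolution_operator_def by metis
  show "ode_solution (\<lambda>t. blinfun_apply (A t)) (\<lambda>t. T t s w)"
    using v(1) by (simp only: eq)
  show "T s s w = w"
    using v(2) by (simp only: eq)
qed

lemma T_comp: "T t r (T r s w) = T t s w"
  using evolution T_solution[of s w] unfolding evolution_operator_def by metis

text \<open>Pointwise solutions only give strong differentiability. Solving \<open>U' = A U\<close> in the Banach
  algebra of operators gives differentiability in norm, and \<open>U\<^sub>t = T\<^sub>t\<^sub>,\<^sub>0\<close> because both
  propagate the same solutions.\<close>

lemma T_forward_derivative: "((\<lambda>t. T t 0) has_vector_derivative (A t o\<^sub>L T t 0)) (at t)"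
proof -
  have "\<exists>U. ode_solution (\<lambda>t Z. A t o\<^sub>L Z) U \<and> U 0 = id_blinfun"
  proof (rule ode_solution_exists[OF _ _ continuous_norm_A])
    show "continuous_on UNIV (\<lambda>(t, Z). A t o\<^sub>L (Z :: 'a \<Rightarrow>\<^sub>L 'a))"
      unfolding split_beta
      by (intro bounded_bilinear.continuous_on[OF bounded_bilinear_blinfun_compose]
          continuous_on_compose2[OF continuous_A] continuous_intros) auto
    show "norm ((A t o\<^sub>L x) - (A t o\<^sub>L y)) \<le> norm (A t) * norm (x - y)" for t x and y :: "'a \<Rightarrow>\<^sub>L 'a"
      by (metis bounded_bilinear.diff_right[OF bounded_bilinear_blinfun_compose] norm_blinfun_compose)
  qed (auto simp: bounded_bilinear.zero_right[OF bounded_bilinear_blinfun_compose])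
  then obtain U where U: "ode_solution (\<lambda>t Z. A t o\<^sub>L Z) U" "U 0 = id_blinfun" by blast
  have "U t = T t 0" for t
  proof (rule blinfun_eqI)
    fix w
    have "ode_solution (\<lambda>t. blinfun_apply (A t)) (\<lambda>t. U t w)"
      using U(1) unfolding ode_solution_def
      by (auto intro!: derivative_eq_intros
          blinfun.has_vector_derivative[OF _ has_vector_derivative_const, THEN has_vector_derivative_eq_rhs])
    then have "U t w = T t 0 (U 0 w)"
      using evolution unfolding evolution_operator_def by blast
    then show "U t w = T t 0 w" by (simp add: U(2))
  qed
  then have "U = (\<lambda>t. T t 0)" by auto
  then show ?thesis using U(1) by (simp add: ode_solution_def)
qed

text \<open>The backward family is obtained from its own equation \<open>V' = - V A\<close>: along it
  \<open>V\<^sub>t T\<^sub>t\<^sub>,\<^sub>0\<close> is constant, so \<open>V\<close> is the inverse \<open>T\<^sub>0\<^sub>,\<^sub>t\<close>.\<close>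

lemma T_backward_derivative: "((\<lambda>t. T 0 t) has_vector_derivative - (T 0 t o\<^sub>L A t)) (at t)"
proof -
  have "\<exists>V. ode_solution (\<lambda>t Z. - (Z o\<^sub>L A t)) V \<and> V 0 = id_blinfun"
  proof (rule ode_solution_exists[OF _ _ continuous_norm_A])
    show "continuous_on UNIV (\<lambda>(t, Z). - ((Z :: 'a \<Rightarrow>\<^sub>L 'a) o\<^sub>L A t))"
      unfolding split_beta
      by (intro continuous_on_minus bounded_bilinear.continuous_on[OF bounded_bilinear_blinfun_compose]
          continuous_on_compose2[OF continuous_A] continuous_intros) auto
    show "norm (- (x o\<^sub>L A t) - - (y o\<^sub>L A t)) \<le> norm (A t) * norm (x - y)" for t x and y :: "'a \<Rightarrow>\<^sub>L 'a"
    proof -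
      have "- (x o\<^sub>L A t) - - (y o\<^sub>L A t) = - ((x - y) o\<^sub>L A t)"
        by (simp add: bounded_bilinear.diff_left[OF bounded_bilinear_blinfun_compose])
      then show ?thesis
        using norm_blinfun_compose[of "x - y" "A t"] by (simp add: mult.commute)
    qed
  qed (auto simp: bounded_bilinear.zero_left[OF bounded_bilinear_blinfun_compose])
  then obtain V where V: "ode_solution (\<lambda>t Z. - (Z o\<^sub>L A t)) V" "V 0 = id_blinfun" by blast
  have "V t = T 0 t" for t
  proof (rule blinfun_eqI)
    fix w
    have "((\<lambda>r. V r o\<^sub>L T r 0) has_vector_derivative
        (V r o\<^sub>L (A r o\<^sub>L T r 0)) + (- (V r o\<^sub>L A r) o\<^sub>L T r 0)) (at r)" for r
      using V(1) unfolding ode_solution_def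
      by (intro bounded_bilinear.has_vector_derivative[OF bounded_bilinear_blinfun_compose]
          T_forward_derivative) auto
    moreover have "(V r o\<^sub>L (A r o\<^sub>L T r 0)) + (- (V r o\<^sub>L A r) o\<^sub>L T r 0) = 0" for r
      by (rule blinfun_eqI) (simp add: blinfun.add_left blinfun.minus_left)
    ultimately have "V t o\<^sub>L T t 0 = V 0 o\<^sub>L T 0 0"
      by (intro constant_if_zero_derivative) simp
    then have "V t (T t 0 (T 0 t w)) = V 0 (T 0 0 (T 0 t w))"
      by (metis blinfun_apply_blinfun_compose)
    then show "V t w = T 0 t w"
      by (simp add: T_comp T_refl V(2))
  qed
  then have "V = (\<lambda>t. T 0 t)" by auto
  then show ?thesis using V(1) by (simp add: ode_solution_def)
qed

lemma continuous_forward: "continuous_on X (\<lambda>t. T t 0)"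
  and continuous_backward: "continuous_on X (\<lambda>t. T 0 t)"
  using T_forward_derivative T_backward_derivative
  by (meson continuous_at_imp_continuous_on has_vector_derivative_continuous)+

text \<open>In the moving frame \<open>T\<^sub>0\<^sub>,\<^sub>t\<close> the linear part disappears; this is the
  variation-of-constants formula.\<close>

lemma moving_frame_derivative:
  assumes "(v has_vector_derivative (A t (v t) + g)) (at t)"
  shows "((\<lambda>t. T 0 t (v t)) has_vector_derivative T 0 t g) (at t)"
  by (rule has_vector_derivative_eq_rhs[OF blinfun.has_vector_derivative[OF T_backward_derivative assms]])
    (simp add: blinfun.add_right blinfun.minus_left)

lemma moving_frame_solution:
  assumes "((\<lambda>t. T 0 t (v t)) has_vector_derivative T 0 t g) (at t)"
  shows "(v has_vector_derivative (A t (v t) + g)) (at t)"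
proof -
  have "((\<lambda>t. T t 0 (T 0 t (v t))) has_vector_derivative
      T t 0 (T 0 t g) + (A t o\<^sub>L T t 0) (T 0 t (v t))) (at t)"
    by (rule blinfun.has_vector_derivative[OF T_forward_derivative assms])
  then show ?thesis by (simp add: T_comp T_refl add.commute)
qed

end

section \<open>The trichotomy and the Lipschitz bounds\<close>

locale trichotomy_problem = linear_evolution A T
  for A :: "real \<Rightarrow> 'a::banach \<Rightarrow>\<^sub>L 'a" and T :: "real \<Rightarrow> real \<Rightarrow> 'a \<Rightarrow>\<^sub>L 'a" +
  fixes P Qp Qm :: "real \<Rightarrow> 'a \<Rightarrow>\<^sub>L 'a" and f :: "real \<Rightarrow> 'a \<Rightarrow> 'a"
    and a b c d D \<epsilon> \<delta> \<gamma> :: real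
  assumes D: "D \<ge> 1" and eps: "\<epsilon> \<ge> 0"
    and trichotomy: "nonuniform_exp_trichotomy T P Qp Qm a b c d D \<epsilon>"
    and continuous_f: "continuous_on UNIV (\<lambda>(t, x). f t x)"
    and f_zero: "f t 0 = 0"
    and Lip_finite: "Lip (f t) < \<infinity>"
    and Lip_le: "r \<noteq> 0 \<Longrightarrow> enn2real (Lip (f r)) \<le> \<delta> / (D\<^sup>2 * exp (2 * \<epsilon> * \<bar>r\<bar>)) *
           Min {- c - d - \<epsilon> * sgn r, - a - b + \<epsilon> * sgn r, D * \<gamma> / 2 * exp ((\<epsilon> - \<gamma>) * \<bar>r\<bar>)}"
    and delta: "\<delta> < 1 / 6"
    and gamma_pos: "\<gamma> > 0"
    and gap_ab: "a + b + \<epsilon> < 0" and gap_cd: "c + d + \<epsilon> < 0"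
begin

abbreviation "\<alpha> \<equiv> exp_alpha D a c \<epsilon>"
abbreviation "\<beta>p \<equiv> exp_beta_plus D d \<epsilon>"
abbreviation "\<beta>m \<equiv> exp_beta_minus D b \<epsilon>"

lemma splitting: "invariant_splitting T P Qp Qm"
  and norm_T_P: "norm (T t s o\<^sub>L P s) \<le> \<alpha> t s"
  and norm_T_Qp: "s \<le> t \<Longrightarrow> norm (T t s o\<^sub>L Qp s) \<le> \<beta>p t s"
  and norm_T_Qm: "t \<le> s \<Longrightarrow> norm (T t s o\<^sub>L Qm s) \<le> \<beta>m t s"
  using trichotomy unfolding nonuniform_exp_trichotomy_def generalized_trichotomy_def by blast+

lemma P_P [simp]: "P t (P t x) = P t x" and Qp_Qp [simp]: "Qp t (Qp t x) = Qp t x"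
  and Qm_Qm [simp]: "Qm t (Qm t x) = Qm t x" and P_Qp [simp]: "P t (Qp t x) = 0"
  and P_T: "P t (T t s x) = T t s (P s x)" and Qp_T: "Qp t (T t s x) = T t s (Qp s x)"
  using splitting unfolding invariant_splitting_def
  by (metis blinfun_apply_blinfun_compose zero_blinfun.rep_eq)+

lemma sum_projections: "P t x + Qp t x + Qm t x = x"
proof -
  have "(P t + Qp t + Qm t) x = x"
    using splitting unfolding invariant_splitting_def by simp
  then show ?thesis by (simp add: blinfun.add_left)
qed

lemma Qm_eq: "Qm t x = x - P t x - Qp t x"
  using sum_projections[of t x] by (simp add: algebra_simps)

text \<open>Only \<open>P Q\<^sup>+ = 0\<close> is part of the splitting. The other products of projections vanish because
  \<open>Q\<^sup>- = Id - P - Q\<^sup>+\<close> is idempotent.\<close>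

lemma Qp_P [simp]: "Qp t (P t x) = 0"
proof -
  have "Qm t (Qm t x) = Qm t x + Qp t (P t x)"
    by (simp add: Qm_eq blinfun.diff_right)
  then show ?thesis by simp
qed

lemma Qm_P [simp]: "Qm t (P t x) = 0" and P_Qm [simp]: "P t (Qm t x) = 0"
  and Qp_Qm [simp]: "Qp t (Qm t x) = 0" and Qm_Qp [simp]: "Qm t (Qp t x) = 0"
  and Qm_T: "Qm t (T t s x) = T t s (Qm s x)"
  by (simp_all add: Qm_eq blinfun.diff_right P_T Qp_T)

lemma mem_center_bundle: "(t, x) \<in> center_bundle P \<longleftrightarrow> P t x = x"
  by (auto simp: center_bundle_def) (metis rangeI)

lemma gap_pos: "- c - d - \<epsilon> * sgn r > 0" "- a - b + \<epsilon> * sgn r > 0"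
  using gap_ab gap_cd eps by (auto simp: sgn_if)

text \<open>The assumed majorant of \<open>Lip(f\<^sub>r)\<close> for \<open>r \<noteq> 0\<close>.\<close>

definition lip :: "real \<Rightarrow> real" where
  "lip r = \<delta> / (D\<^sup>2 * exp (2 * \<epsilon> * \<bar>r\<bar>)) *
    Min {- c - d - \<epsilon> * sgn r, - a - b + \<epsilon> * sgn r, D * \<gamma> / 2 * exp ((\<epsilon> - \<gamma>) * \<bar>r\<bar>)}"

lemma min_pos:
  "Min {- c - d - \<epsilon> * sgn r, - a - b + \<epsilon> * sgn r, D * \<gamma> / 2 * exp ((\<epsilon> - \<gamma>) * \<bar>r\<bar>)} > 0"
  using gap_pos[of r] gamma_pos D by simp

text \<open>A negative \<open>\<delta>\<close> would bound a Lipschitz constant by a negative number.\<close>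

lemma delta_nonneg: "\<delta> \<ge> 0"
proof (rule ccontr)
  assume "\<not> \<delta> \<ge> 0"
  moreover have "D\<^sup>2 * exp (2 * \<epsilon> * \<bar>1\<bar>) > 0" using D by simp
  ultimately have "lip 1 < 0"
    unfolding lip_def using min_pos[of 1] by (intro mult_neg_pos divide_neg_pos) auto
  moreover have "0 \<le> lip 1"
    using Lip_le[of 1] unfolding lip_def by (intro order_trans[OF enn2real_nonneg]) auto
  ultimately show False by simp
qed

text \<open>Each entry of the minimum serves one integral: the third one the central equation, the first
  and the second one the stable and the unstable direction.\<close>

lemma lip_bounds:
  shows lip_nonneg: "lip r \<ge> 0"
    and lip_center: "D * exp (\<epsilon> * \<bar>r\<bar>) * lip r \<le> \<delta> * \<gamma> / 2 * exp (- \<gamma> * \<bar>r\<bar>)"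
    and lip_plus: "D\<^sup>2 * exp (2 * \<epsilon> * \<bar>r\<bar>) * lip r \<le> \<delta> * (- c - d - \<epsilon> * sgn r)"
    and lip_minus: "D\<^sup>2 * exp (2 * \<epsilon> * \<bar>r\<bar>) * lip r \<le> \<delta> * (- a - b + \<epsilon> * sgn r)"
proof -
  define m where "m = Min {- c - d - \<epsilon> * sgn r, - a - b + \<epsilon> * sgn r, D * \<gamma> / 2 * exp ((\<epsilon> - \<gamma>) * \<bar>r\<bar>)}"
  define w where "w = D\<^sup>2 * exp (2 * \<epsilon> * \<bar>r\<bar>)"
  have w: "w > 0" using D by (simp add: w_def)
  have m: "m > 0" using min_pos[of r] by (simp only: m_def)
  have le: "m \<le> - c - d - \<epsilon> * sgn r" "m \<le> - a - b + \<epsilon> * sgn r"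
    "m \<le> D * \<gamma> / 2 * exp ((\<epsilon> - \<gamma>) * \<bar>r\<bar>)"
    unfolding m_def by (rule Min_le; simp)+
  have lip: "lip r = \<delta> / w * m" by (simp only: lip_def m_def w_def)
  show "lip r \<ge> 0"
    using w m delta_nonneg by (simp add: lip)
  have eq: "w * lip r = \<delta> * m" using w by (simp add: lip)
  then show "D\<^sup>2 * exp (2 * \<epsilon> * \<bar>r\<bar>) * lip r \<le> \<delta> * (- c - d - \<epsilon> * sgn r)"
    "D\<^sup>2 * exp (2 * \<epsilon> * \<bar>r\<bar>) * lip r \<le> \<delta> * (- a - b + \<epsilon> * sgn r)"
    unfolding w_def[symmetric] using le delta_nonneg by (auto intro!: mult_left_mono)
  define e where "e = exp (\<epsilon> * \<bar>r\<bar>)"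
  have w2: "w = D * e * (D * e)"
    by (simp add: w_def e_def power2_eq_square flip: exp_add)
  have De: "D * e > 0" using D by (simp add: e_def)
  have "D * e * lip r = (w * lip r) / (D * e)"
    using De D by (simp add: w2)
  also have "\<dots> \<le> \<delta> * (D * \<gamma> / 2 * exp ((\<epsilon> - \<gamma>) * \<bar>r\<bar>)) / (D * e)"
    unfolding eq using le(3) delta_nonneg De by (intro divide_right_mono mult_left_mono) auto
  also have "exp ((\<epsilon> - \<gamma>) * \<bar>r\<bar>) = e * exp (- \<gamma> * \<bar>r\<bar>)"
    by (simp add: e_def algebra_simps flip: exp_add)
  also have "\<delta> * (D * \<gamma> / 2 * (e * exp (- \<gamma> * \<bar>r\<bar>))) / (D * e) = \<delta> * \<gamma> / 2 * exp (- \<gamma> * \<bar>r\<bar>)"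
    using D by (simp add: e_def field_simps)
  finally show "D * exp (\<epsilon> * \<bar>r\<bar>) * lip r \<le> \<delta> * \<gamma> / 2 * exp (- \<gamma> * \<bar>r\<bar>)"
    by (simp add: e_def)
qed

lemma Lip_le_lip: "r \<noteq> 0 \<Longrightarrow> Lip (f r) \<le> ennreal (lip r)"
  by (metis Lip_le Lip_finite lip_def ennreal_enn2real ennreal_leI infinity_ennreal_def)

lemma f_Lip: "norm (f r x - f r y) \<le> enn2real (Lip (f r)) * norm (x - y)"
proof (cases "x = y")
  case False
  have "ennreal (norm (f r x - f r y) / norm (x - y)) \<le> Lip (f r)"
    unfolding Lip_def using False by (auto intro!: SUP_upper2[of "(x, y)"])
  then have "norm (f r x - f r y) / norm (x - y) \<le> enn2real (Lip (f r))"
    by (metis Lip_finite divide_nonneg_nonneg enn2real_ennreal enn2real_mono infinity_ennreal_def norm_ge_zero)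
  then show ?thesis using False by (simp add: field_simps)
qed simp

lemma f_lip: "r \<noteq> 0 \<Longrightarrow> norm (f r x - f r y) \<le> lip r * norm (x - y)"
  using f_Lip[of r x y] Lip_le[of r, folded lip_def]
  by (meson mult_right_mono norm_ge_zero order_trans)

text \<open>A Lipschitz constant of all \<open>f\<^sub>r\<close>, including \<open>r = 0\<close>; it makes the nonlinear equations
  globally solvable.\<close>

definition uniform_lip :: real where "uniform_lip = max (\<delta> * \<gamma> / 2) (enn2real (Lip (f 0)))"

lemma uniform_lip: "norm (f r x - f r y) \<le> uniform_lip * norm (x - y)" and uniform_lip_nonneg: "uniform_lip \<ge> 0"
proof -
  show "uniform_lip \<ge> 0" by (simp add: uniform_lip_def le_max_iff_disj)
  have "enn2real (Lip (f r)) \<le> uniform_lip"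
  proof (cases "r = 0")
    case False
    have "1 * lip r \<le> (D * exp (\<epsilon> * \<bar>r\<bar>)) * lip r"
      using D eps lip_nonneg[of r] mult_mono[of 1 D 1 "exp (\<epsilon> * \<bar>r\<bar>)"] by (intro mult_right_mono) auto
    also have "\<dots> \<le> \<delta> * \<gamma> / 2 * 1"
      using gamma_pos delta_nonneg by (intro order_trans[OF lip_center] mult_left_mono) auto
    finally show ?thesis
      using Lip_le[OF False, folded lip_def] by (simp add: uniform_lip_def)
  qed (simp add: uniform_lip_def)
  then show "norm (f r x - f r y) \<le> uniform_lip * norm (x - y)"
    using f_Lip[of r x y] by (meson mult_right_mono norm_ge_zero order_trans)
qed

lemma f_norm_le: "norm (f r x) \<le> uniform_lip * norm x"
  using uniform_lip[of r x 0] by (simp add: f_zero)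

lemma alpha_le: "t \<le> s \<Longrightarrow> \<alpha> t s = D * exp (c * (s - t) + \<epsilon> * \<bar>s\<bar>)"
  and alpha_ge: "s \<le> t \<Longrightarrow> \<alpha> t s = D * exp (a * (t - s) + \<epsilon> * \<bar>s\<bar>)"
  by (auto simp: exp_alpha_def)

lemma alpha_pos: "\<alpha> t s > 0"
  using D by (simp add: exp_alpha_def)

text \<open>Between \<open>s\<close> and \<open>t\<close> the bound \<open>\<alpha>\<close> is multiplicative up to a factor that does not depend on
  \<open>s\<close> and \<open>t\<close>. This makes \<open>\<alpha>\<^sub>r\<^sub>,\<^sub>s\<close> a suitable weight for trajectories through time \<open>s\<close>.\<close>

lemma alpha_mult:
  assumes "r \<in> closed_segment s t"
  shows "\<alpha> t r * \<alpha> r s = D * exp (\<epsilon> * \<bar>r\<bar>) * \<alpha> t s"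
proof (cases "s \<le> t")
  case True
  then have "s \<le> r" "r \<le> t" using assms by (auto simp: closed_segment_eq_real_ivl)
  then show ?thesis using True by (simp add: alpha_ge algebra_simps flip: exp_add)
next
  case False
  then have "r \<le> s" "t \<le> r" using assms by (auto simp: closed_segment_eq_real_ivl)
  then show ?thesis using False by (simp add: alpha_le algebra_simps flip: exp_add)
qed

lemma continuous_alpha: "continuous_on (closed_segment s t) (\<lambda>r. \<alpha> r s)"
proof (cases "s \<le> t")
  case True
  have "continuous_on {s..t} (\<lambda>r. D * exp (a * (r - s) + \<epsilon> * \<bar>s\<bar>))"
    by (intro continuous_intros)
  then show ?thesis using True
    by (subst continuous_on_cong[OF refl, of _ _ "\<lambda>r. D * exp (a * (r - s) + \<epsilon> * \<bar>s\<bar>)"])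
      (auto simp: closed_segment_eq_real_ivl alpha_ge)
next
  case False
  have "continuous_on {t..s} (\<lambda>r. D * exp (c * (s - r) + \<epsilon> * \<bar>s\<bar>))"
    by (intro continuous_intros)
  then show ?thesis using False
    by (subst continuous_on_cong[OF refl, of _ _ "\<lambda>r. D * exp (c * (s - r) + \<epsilon> * \<bar>s\<bar>)"])
      (auto simp: closed_segment_eq_real_ivl alpha_le)
qed

text \<open>The densities majorize the two integrands in the definition of \<open>\<omega>\<close>, and the primitives are
  normalized to vanish at \<open>-\<infinity>\<close> and \<open>+\<infinity>\<close>, respectively. Their values at \<open>r = s\<close>,
  \<open>\<delta>\<close> and \<open>-\<delta>\<close>, show that both integrals are at most \<open>\<delta>\<close>.\<close>

definition plus_primitive :: "real \<Rightarrow> real \<Rightarrow> real" where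
  "plus_primitive s r = \<delta> * exp ((c + d) * (s - r) + \<epsilon> * \<bar>s\<bar> - \<epsilon> * \<bar>r\<bar>)"
definition plus_density :: "real \<Rightarrow> real \<Rightarrow> real" where
  "plus_density s r = \<delta> * (- c - d - \<epsilon> * sgn r) * exp ((c + d) * (s - r) + \<epsilon> * \<bar>s\<bar> - \<epsilon> * \<bar>r\<bar>)"
definition minus_primitive :: "real \<Rightarrow> real \<Rightarrow> real" where
  "minus_primitive s r = - \<delta> * exp ((a + b) * (r - s) + \<epsilon> * \<bar>s\<bar> - \<epsilon> * \<bar>r\<bar>)"
definition minus_density :: "real \<Rightarrow> real \<Rightarrow> real" where
  "minus_density s r = \<delta> * (- a - b + \<epsilon> * sgn r) * exp ((a + b) * (r - s) + \<epsilon> * \<bar>s\<bar> - \<epsilon> * \<bar>r\<bar>)"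

lemma abs_derivative:
  assumes "r \<noteq> 0"
  shows "(abs has_real_derivative sgn r) (at r)"
proof (rule has_field_derivative_transform_within_open)
  show "((\<lambda>x. sgn r * x) has_real_derivative sgn r) (at r)"
    by (auto intro!: derivative_eq_intros)
  show "open {x. 0 < sgn r * x}"
    by (intro open_Collect_less continuous_intros)
qed (use assms in \<open>auto simp: sgn_if split: if_splits\<close>)

lemma plus_primitive_derivative:
  "r \<noteq> 0 \<Longrightarrow> (plus_primitive s has_vector_derivative plus_density s r) (at r)"
  unfolding has_real_derivative_iff_has_vector_derivative[symmetric]
    plus_primitive_def[abs_def] plus_density_def
  by (rule derivative_eq_intros abs_derivative refl | assumption)+ (simp add: algebra_simps)

lemma minus_primitive_derivative:
  "r \<noteq> 0 \<Longrightarrow> (minus_primitive s has_vector_derivative minus_density s r) (at r)"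
  unfolding has_real_derivative_iff_has_vector_derivative[symmetric]
    minus_primitive_def[abs_def] minus_density_def
  by (rule derivative_eq_intros abs_derivative refl | assumption)+ (simp add: algebra_simps)

lemma continuous_primitives:
  "continuous_on X (plus_primitive s)" "continuous_on X (minus_primitive s)"
  unfolding plus_primitive_def[abs_def] minus_primitive_def[abs_def]
  by (intro continuous_intros)+

lemma primitives_at_base [simp]: "plus_primitive s s = \<delta>" "minus_primitive s s = - \<delta>"
  by (simp_all add: plus_primitive_def minus_primitive_def)

lemma primitives_sign: "plus_primitive s r \<ge> 0" "minus_primitive s r \<le> 0"
  using delta_nonneg by (simp_all add: plus_primitive_def minus_primitive_def)

lemma densities_nonneg: "plus_density s r \<ge> 0" "minus_density s r \<ge> 0"
  unfolding plus_density_def minus_density_def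
  using delta_nonneg gap_pos[of r] by (intro mult_nonneg_nonneg; simp)+

lemma plus_density_bound:
  assumes "r \<le> s" shows "\<beta>p s r * lip r * \<alpha> r s \<le> plus_density s r"
proof -
  let ?e = "exp ((c + d) * (s - r) + \<epsilon> * \<bar>s\<bar> - \<epsilon> * \<bar>r\<bar>)"
  have "\<beta>p s r * lip r * \<alpha> r s = (D\<^sup>2 * exp (2 * \<epsilon> * \<bar>r\<bar>) * lip r) * ?e"
    using assms by (simp add: exp_beta_plus_def alpha_le power2_eq_square)
      (simp add: algebra_simps flip: exp_add)
  also have "\<dots> \<le> \<delta> * (- c - d - \<epsilon> * sgn r) * ?e"
    by (intro mult_right_mono lip_plus) simp
  finally show ?thesis by (simp only: plus_density_def)
qed

lemma minus_density_bound:
  assumes "s \<le> r" shows "\<beta>m s r * lip r * \<alpha> r s \<le> minus_density s r"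
proof -
  let ?e = "exp ((a + b) * (r - s) + \<epsilon> * \<bar>s\<bar> - \<epsilon> * \<bar>r\<bar>)"
  have "\<beta>m s r * lip r * \<alpha> r s = (D\<^sup>2 * exp (2 * \<epsilon> * \<bar>r\<bar>) * lip r) * ?e"
    using assms by (simp add: exp_beta_minus_def alpha_ge power2_eq_square)
      (simp add: algebra_simps flip: exp_add)
  also have "\<dots> \<le> \<delta> * (- a - b + \<epsilon> * sgn r) * ?e"
    by (intro mult_right_mono lip_minus) simp
  finally show ?thesis by (simp only: minus_density_def)
qed

lemma plus_primitive_at_bot: "(plus_primitive s \<longlongrightarrow> 0) at_bot"
proof -
  have "filterlim (\<lambda>r. (\<epsilon> - (c + d)) * r) at_bot at_bot"
    using gap_cd eps
    by (intro filterlim_tendsto_pos_mult_at_bot[OF tendsto_const] filterlim_ident) auto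
  then have "((\<lambda>r. \<delta> * exp ((c + d) * s + \<epsilon> * \<bar>s\<bar>) * exp ((\<epsilon> - (c + d)) * r))
      \<longlongrightarrow> \<delta> * exp ((c + d) * s + \<epsilon> * \<bar>s\<bar>) * 0) at_bot"
    by (intro tendsto_mult tendsto_const filterlim_compose[OF exp_at_bot])
  moreover have "eventually (\<lambda>r. \<delta> * exp ((c + d) * s + \<epsilon> * \<bar>s\<bar>) * exp ((\<epsilon> - (c + d)) * r)
      = plus_primitive s r) at_bot"
    using eventually_le_at_bot[of 0]
    by eventually_elim (simp add: plus_primitive_def algebra_simps flip: exp_add)
  ultimately show ?thesis by (simp add: tendsto_cong)
qed

lemma minus_primitive_at_top: "(minus_primitive s \<longlongrightarrow> 0) at_top"
proof -
  have "filterlim (\<lambda>r. (a + b - \<epsilon>) * r) at_bot at_top"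
    using gap_ab eps
    by (intro filterlim_tendsto_neg_mult_at_bot[OF tendsto_const] filterlim_ident) auto
  then have "((\<lambda>r. - \<delta> * exp (\<epsilon> * \<bar>s\<bar> - (a + b) * s) * exp ((a + b - \<epsilon>) * r))
      \<longlongrightarrow> - \<delta> * exp (\<epsilon> * \<bar>s\<bar> - (a + b) * s) * 0) at_top"
    by (intro tendsto_mult tendsto_const filterlim_compose[OF exp_at_bot])
  moreover have "eventually (\<lambda>r. - \<delta> * exp (\<epsilon> * \<bar>s\<bar> - (a + b) * s) * exp ((a + b - \<epsilon>) * r)
      = minus_primitive s r) at_top"
    using eventually_ge_at_top[of 0]
    by eventually_elim (simp add: minus_primitive_def algebra_simps flip: exp_add)
  ultimately show ?thesis by (simp add: tendsto_cong)
qed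

section \<open>Trajectories on the center bundle\<close>

text \<open>The slope \<open>N = 6\<delta>\<close> is large enough for \<open>2\<delta> \<cdot> (1 + N) \<cdot> 3/2 \<le> N\<close> and small enough for
  \<open>N < 1\<close>.\<close>

abbreviation "slope \<equiv> 6 * \<delta>"
abbreviation "slope_maps \<equiv> graph_maps P Qp Qm slope"

lemma slope_range: "0 \<le> slope" "slope < 1"
  using delta delta_nonneg by auto

lemma graph_maps_iff:
  "\<phi> \<in> graph_maps P Qp Qm K \<longleftrightarrow> \<phi> \<in> extensional (center_bundle P) \<and>
    continuous_on (center_bundle P) \<phi> \<and> (\<forall>t. \<phi> (t, 0) = 0) \<and>
    (\<forall>t \<xi>. P t \<xi> = \<xi> \<longrightarrow> P t (\<phi> (t, \<xi>)) = 0) \<and>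
    (\<forall>t \<xi> \<xi>'. P t \<xi> = \<xi> \<longrightarrow> P t \<xi>' = \<xi>' \<longrightarrow>
      norm (\<phi> (t, \<xi>) - \<phi> (t, \<xi>')) \<le> K * norm (\<xi> - \<xi>'))"
proof -
  have "(\<exists>u \<in> range (Qp t). \<exists>w \<in> range (Qm t). v = u + w) \<longleftrightarrow> P t v = 0" for t v
  proof
    assume "P t v = 0"
    then have "v = Qp t v + Qm t v" using sum_projections[of t v] by simp
    then show "\<exists>u \<in> range (Qp t). \<exists>w \<in> range (Qm t). v = u + w" by blast
  qed (auto simp: blinfun.add_right)
  moreover have "(\<forall>p \<in> center_bundle P. P (fst p) (\<phi> p) = 0) \<longleftrightarrow>
      (\<forall>t \<xi>. P t \<xi> = \<xi> \<longrightarrow> P t (\<phi> (t, \<xi>)) = 0)"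
    by (auto simp flip: mem_center_bundle)
  ultimately show ?thesis
    by (simp add: graph_maps_def mem_center_bundle split_beta)
qed

lemma slope_mapsD:
  assumes "\<phi> \<in> slope_maps"
  shows "continuous_on (center_bundle P) \<phi>" "\<phi> (t, 0) = 0"
    and "P t \<xi> = \<xi> \<Longrightarrow> P t (\<phi> (t, \<xi>)) = 0"
    and "P t \<xi> = \<xi> \<Longrightarrow> P t \<xi>' = \<xi>' \<Longrightarrow> norm (\<phi> (t, \<xi>) - \<phi> (t, \<xi>')) \<le> slope * norm (\<xi> - \<xi>')"
    and "P t \<xi> = \<xi> \<Longrightarrow> norm (\<phi> (t, \<xi>)) \<le> slope * norm \<xi>"
proof -
  note * = assms[unfolded graph_maps_iff]
  show "continuous_on (center_bundle P) \<phi>" "\<phi> (t, 0) = 0"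
    "P t \<xi> = \<xi> \<Longrightarrow> P t (\<phi> (t, \<xi>)) = 0" using * by auto
  show lip: "norm (\<phi> (t, \<xi>) - \<phi> (t, \<xi>')) \<le> slope * norm (\<xi> - \<xi>')" if "P t \<xi> = \<xi>" "P t \<xi>' = \<xi>'" for \<xi> \<xi>'
    using * that by auto
  show "norm (\<phi> (t, \<xi>)) \<le> slope * norm \<xi>" if "P t \<xi> = \<xi>"
    using lip[OF that, of 0] * by (simp add: blinfun.zero_right)
qed

lemma continuous_on_map_path:
  assumes "\<phi> \<in> slope_maps" "continuous_on X u" "continuous_on X x"
    and "\<And>t. t \<in> X \<Longrightarrow> P (u t) (x t) = x t"
  shows "continuous_on X (\<lambda>t. f (u t) (x t + \<phi> (u t, x t)))"
proof -
  have "continuous_on X (\<lambda>t. \<phi> (u t, x t))"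
    using assms by (intro continuous_on_compose2[OF slope_mapsD(1)[OF assms(1)]] continuous_intros)
      (auto simp: mem_center_bundle)
  then have "continuous_on X (\<lambda>t. (\<lambda>(t, x). f t x) (u t, x t + \<phi> (u t, x t)))"
    using assms(2,3) by (intro continuous_on_compose2[OF continuous_f] continuous_intros) auto
  then show ?thesis by simp
qed

definition forcing :: "(real \<times> 'a \<Rightarrow> 'a) \<Rightarrow> (real \<Rightarrow> 'a) \<Rightarrow> real \<Rightarrow> 'a" where
  "forcing \<phi> x t = f t (x t + \<phi> (t, x t))"

text \<open>The central equation \<open>x' = A(t) x + P\<^sub>t f(t, x + \<phi>(t, x))\<close>, written in the moving frame.\<close>

definition center_trajectory :: "(real \<times> 'a \<Rightarrow> 'a) \<Rightarrow> (real \<Rightarrow> 'a) \<Rightarrow> bool" where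
  "center_trajectory \<phi> x \<longleftrightarrow> (\<forall>t. P t (x t) = x t \<and>
    ((\<lambda>t. T 0 t (x t)) has_vector_derivative P 0 (T 0 t (forcing \<phi> x t))) (at t))"

lemma center_trajectory_mem: "center_trajectory \<phi> x \<Longrightarrow> P t (x t) = x t"
  by (simp add: center_trajectory_def)

lemma continuous_in_moving_frame:
  assumes "\<And>t. ((\<lambda>t. T 0 t (x t)) has_vector_derivative g t) (at t)"
  shows "continuous_on X x"
proof -
  have "continuous_on X (\<lambda>t. T 0 t (x t))"
    using assms by (meson continuous_at_imp_continuous_on has_vector_derivative_continuous)
  then have "continuous_on X (\<lambda>t. T t 0 (T 0 t (x t)))"
    by (rule blinfun.continuous_on[OF continuous_forward])
  then show ?thesis by (simp add: T_comp T_refl)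
qed

lemma center_trajectory_continuous: "center_trajectory \<phi> x \<Longrightarrow> continuous_on X x"
  by (rule continuous_in_moving_frame[where g = "\<lambda>t. P 0 (T 0 t (forcing \<phi> x t))"])
    (simp add: center_trajectory_def)

lemma forcing_continuous:
  assumes "\<phi> \<in> slope_maps" "center_trajectory \<phi> x"
  shows "continuous_on X (forcing \<phi> x)"
  unfolding forcing_def[abs_def]
  using assms by (intro continuous_on_map_path continuous_on_id center_trajectory_continuous)
    (auto simp: center_trajectory_mem)

lemma center_trajectory_zero:
  assumes "\<phi> \<in> slope_maps"
  shows "center_trajectory \<phi> (\<lambda>_. 0)"
  using slope_mapsD[OF assms] by (simp add: center_trajectory_def forcing_def f_zero blinfun.zero_right)

text \<open>The equation lives on the bundle \<open>E\<close> only. Composition with \<open>P\<^sub>0\<close> extends it to an equation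
  \<open>z' = F(t, z)\<close> on the whole space, in the moving frame; the range of \<open>F\<close> keeps \<open>z\<close> in the range
  of \<open>P\<^sub>0\<close>.\<close>

lemma center_trajectory_exists:
  assumes \<phi>: "\<phi> \<in> slope_maps" and \<xi>: "P s \<xi> = \<xi>"
  shows "\<exists>x. center_trajectory \<phi> x \<and> x s = \<xi>"
proof -
  define F where "F t z = P 0 (T 0 t (f t (T t 0 (P 0 z) + \<phi> (t, T t 0 (P 0 z)))))" for t z
  define L where "L t = norm (P 0) * (norm (T 0 t) * (uniform_lip * (2 * (norm (T t 0) * norm (P 0)))))" for t
  have mem: "P t (T t 0 (P 0 z)) = T t 0 (P 0 z)" for t z
    by (simp add: P_T)
  have "\<exists>z. ode_solution F z \<and> z s = T 0 s \<xi>"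
  proof (rule ode_solution_exists)
    have fwd: "continuous_on UNIV (\<lambda>p::real \<times> 'a. T (fst p) 0)"
      by (rule continuous_on_compose2[OF continuous_forward[of UNIV] continuous_on_fst[OF continuous_on_id]]) simp
    have bwd: "continuous_on UNIV (\<lambda>p::real \<times> 'a. T 0 (fst p))"
      by (rule continuous_on_compose2[OF continuous_backward[of UNIV] continuous_on_fst[OF continuous_on_id]]) simp
    have Pz: "continuous_on UNIV (\<lambda>p::real \<times> 'a. P 0 (snd p))"
      by (rule blinfun.continuous_on[OF continuous_on_const continuous_on_snd[OF continuous_on_id]])
    have "continuous_on UNIV (\<lambda>p. f (fst p) (T (fst p) 0 (P 0 (snd p)) + \<phi> (fst p, T (fst p) 0 (P 0 (snd p)))))"
      by (rule continuous_on_map_path[OF \<phi> continuous_on_fst[OF continuous_on_id]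
            blinfun.continuous_on[OF fwd Pz] mem])
    from blinfun.continuous_on[OF continuous_on_const blinfun.continuous_on[OF bwd this]]
    show "continuous_on UNIV (\<lambda>(t, z). F t z)"
      unfolding F_def split_beta .
    show "F t 0 = 0" for t
      using slope_mapsD[OF \<phi>] by (simp add: F_def f_zero blinfun.zero_right)
    show "continuous_on UNIV L"
      unfolding L_def by (intro continuous_intros continuous_forward continuous_backward)
    show "L t \<ge> 0" for t
      by (simp add: L_def uniform_lip_nonneg)
    fix t and z z' :: 'a
    let ?w = "T t 0 (P 0 z)" and ?w' = "T t 0 (P 0 z')"
    have "norm (?w + \<phi> (t, ?w) - (?w' + \<phi> (t, ?w'))) \<le> norm (?w - ?w') + norm (\<phi> (t, ?w) - \<phi> (t, ?w'))"
      using norm_triangle_ineq[of "?w - ?w'" "\<phi> (t, ?w) - \<phi> (t, ?w')"] by (simp add: algebra_simps)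
    also have "\<dots> \<le> norm (?w - ?w') + 1 * norm (?w - ?w')"
      using slope_range
      by (intro add_left_mono order_trans[OF slope_mapsD(4)[OF \<phi> mem mem]] mult_right_mono) auto
    also have "\<dots> = 2 * norm (T t 0 (P 0 (z - z')))" by (simp add: blinfun.diff_right)
    also have "\<dots> \<le> 2 * ((norm (T t 0) * norm (P 0)) * norm (z - z'))"
    proof -
      have "norm (T t 0 (P 0 (z - z'))) \<le> norm (T t 0) * (norm (P 0) * norm (z - z'))"
        by (rule order_trans[OF norm_blinfun]) (intro mult_left_mono norm_blinfun norm_ge_zero)
      then show ?thesis by (simp add: mult.assoc)
    qed
    finally have 2: "norm (?w + \<phi> (t, ?w) - (?w' + \<phi> (t, ?w')))
        \<le> 2 * ((norm (T t 0) * norm (P 0)) * norm (z - z'))" .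
    have "norm (F t z - F t z') = norm (P 0 (T 0 t (f t (?w + \<phi> (t, ?w)) - f t (?w' + \<phi> (t, ?w')))))"
      by (simp add: F_def blinfun.diff_right)
    also have "\<dots> \<le> norm (P 0) * (norm (T 0 t) * norm (f t (?w + \<phi> (t, ?w)) - f t (?w' + \<phi> (t, ?w'))))"
      by (intro order_trans[OF norm_blinfun] mult_left_mono norm_blinfun) auto
    also have "\<dots> \<le> norm (P 0) * (norm (T 0 t) * (uniform_lip * (2 * ((norm (T t 0) * norm (P 0)) * norm (z - z')))))"
      using uniform_lip_nonneg
      by (intro mult_left_mono order_trans[OF uniform_lip] 2) auto
    finally show "norm (F t z - F t z') \<le> L t * norm (z - z')"
      by (simp add: L_def mult_ac)
  qed
  then obtain z where z: "ode_solution F z" "z s = T 0 s \<xi>" by blast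
  have dz: "(z has_vector_derivative F t (z t)) (at t)" for t
    using z(1) by (simp add: ode_solution_def)
  have Pz: "P 0 (z t) = z t" for t
  proof -
    have PF: "P 0 (F r (z r)) = F r (z r)" for r by (simp add: F_def)
    have "((\<lambda>r. z r - P 0 (z r)) has_vector_derivative F r (z r) - P 0 (F r (z r))) (at r)" for r
      by (rule has_vector_derivative_diff[OF dz
            bounded_linear.has_vector_derivative[OF blinfun.bounded_linear_right dz]])
    then have "z t - P 0 (z t) = z s - P 0 (z s)"
      unfolding PF by (intro constant_if_zero_derivative) simp
    then show ?thesis by (simp add: z(2) P_T \<xi>)
  qed
  define x where "x t = T t 0 (z t)" for t
  have Tx: "T 0 t (x t) = z t" for t by (simp add: x_def T_comp T_refl)
  have "F t (z t) = P 0 (T 0 t (forcing \<phi> x t))" for t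
    by (simp add: F_def forcing_def x_def Pz)
  then have "center_trajectory \<phi> x"
    using dz unfolding center_trajectory_def Tx by (simp add: x_def P_T Pz)
  moreover have "x s = \<xi>" by (simp add: x_def z(2) T_comp T_refl)
  ultimately show ?thesis by blast
qed

lemma forcing_diff:
  assumes \<phi>: "\<phi> \<in> slope_maps" and x: "P r (x r) = x r" and y: "P r (y r) = y r"
  shows "norm ((x r + \<phi> (r, x r)) - (y r + \<psi> (r, y r)))
    \<le> 2 * norm (x r - y r) + norm (\<phi> (r, y r) - \<psi> (r, y r))" (is ?A)
    and "r \<noteq> 0 \<Longrightarrow> norm (forcing \<phi> x r - forcing \<psi> y r)
    \<le> lip r * (2 * norm (x r - y r) + norm (\<phi> (r, y r) - \<psi> (r, y r)))"
proof -
  have "(x r + \<phi> (r, x r)) - (y r + \<psi> (r, y r))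
    = (x r - y r) + (\<phi> (r, x r) - \<phi> (r, y r)) + (\<phi> (r, y r) - \<psi> (r, y r))" by simp
  also have "norm \<dots> \<le> norm (x r - y r) + norm (\<phi> (r, x r) - \<phi> (r, y r)) + norm (\<phi> (r, y r) - \<psi> (r, y r))"
    by (rule order_trans[OF norm_triangle_ineq add_right_mono[OF norm_triangle_ineq]])
  also have "norm (\<phi> (r, x r) - \<phi> (r, y r)) \<le> 1 * norm (x r - y r)"
    using slope_range by (intro order_trans[OF slope_mapsD(4)[OF \<phi> x y]] mult_right_mono) auto
  finally show A: ?A by simp
  assume "r \<noteq> 0"
  then show "norm (forcing \<phi> x r - forcing \<psi> y r)
    \<le> lip r * (2 * norm (x r - y r) + norm (\<phi> (r, y r) - \<psi> (r, y r)))"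
    unfolding forcing_def by (intro order_trans[OF f_lip] mult_left_mono A lip_nonneg)
qed

text \<open>This is \<open>sgn(r) (1 - e\<^bsup>-\<gamma>\<bar>r\<bar>\<^esup>) \<delta>/2\<close>, in a form that is visibly continuous: a primitive of
  the integrable majorant of \<open>D e\<^bsup>\<epsilon>\<bar>r\<bar>\<^esup> Lip(f\<^sub>r)\<close>, with total increment \<open>\<delta>\<close>.\<close>

definition center_primitive :: "real \<Rightarrow> real" where
  "center_primitive r = \<delta> / 2 * (exp (- \<gamma> * max 0 (- r)) - exp (- \<gamma> * max 0 r))"

lemma center_primitive_derivative:
  assumes "r \<noteq> 0"
  shows "(center_primitive has_vector_derivative \<delta> * \<gamma> / 2 * exp (- \<gamma> * \<bar>r\<bar>)) (at r)"
proof (cases "r > 0")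
  case True
  have "((\<lambda>r. \<delta> / 2 * (1 - exp (- \<gamma> * r))) has_real_derivative \<delta> * \<gamma> / 2 * exp (- \<gamma> * \<bar>r\<bar>)) (at r)"
    using True by (auto intro!: derivative_eq_intros)
  then show ?thesis
    unfolding has_real_derivative_iff_has_vector_derivative
    by (rule has_vector_derivative_transform_within_open[of _ _ _ "{0<..}"])
      (use True in \<open>auto simp: center_primitive_def\<close>)
next
  case False
  have "((\<lambda>r. \<delta> / 2 * (exp (\<gamma> * r) - 1)) has_real_derivative \<delta> * \<gamma> / 2 * exp (- \<gamma> * \<bar>r\<bar>)) (at r)"
    using False by (auto intro!: derivative_eq_intros)
  then show ?thesis
    unfolding has_real_derivative_iff_has_vector_derivative
    by (rule has_vector_derivative_transform_within_open[of _ _ _ "{..<0}"])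
      (use False assms in \<open>auto simp: center_primitive_def\<close>)
qed

lemma center_primitive_bound: "\<bar>center_primitive t - center_primitive s\<bar> \<le> \<delta>"
proof -
  have "\<bar>center_primitive r\<bar> \<le> \<delta> / 2 * 1" for r
  proof -
    have "exp (- \<gamma> * max 0 x) \<in> {0..1}" for x
      using gamma_pos by auto
    from this[of "-r"] this[of r] have "\<bar>exp (- \<gamma> * max 0 (- r)) - exp (- \<gamma> * max 0 r)\<bar> \<le> 1"
      unfolding atLeastAtMost_iff by linarith
    then show ?thesis
      using delta_nonneg unfolding center_primitive_def abs_mult
      by (intro mult_mono) auto
  qed
  from this[of t] this[of s] show ?thesis by linarith
qed

text \<open>Let \<open>e\<close> be the maximum of \<open>\<parallel>x(r) - y(r)\<parallel> / \<alpha>\<^sub>r\<^sub>,\<^sub>s\<close> over the segment from \<open>s\<close> to \<open>t\<close>. At a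
  point where it is attained, variation of constants gives
  \<open>e \<le> \<parallel>x(s) - y(s)\<parallel> + \<delta> (2 e + C)\<close>, and \<open>2\<delta> \<le> 1/3\<close> yields the factor \<open>3/2\<close>. On the
  compact segment the maximum exists. The number \<open>C\<close> allows for two different maps and measures their distance along \<open>y\<close>.\<close>

lemma center_trajectory_estimate:
  assumes \<phi>: "\<phi> \<in> slope_maps"
    and x: "center_trajectory \<phi> x" and y: "center_trajectory \<psi> y"
    and C: "\<And>r. norm (\<phi> (r, y r) - \<psi> (r, y r)) \<le> C * \<alpha> r s"
  shows "norm (x t - y t) \<le> 3 / 2 * (norm (x s - y s) + \<delta> * C) * \<alpha> t s"
proof -
  let ?S = "closed_segment s t"
  define e where "e r = norm (x r - y r) / \<alpha> r s" for r
  have "continuous_on ?S e"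
    unfolding e_def using alpha_pos
    by (intro continuous_intros continuous_alpha center_trajectory_continuous[OF x]
        center_trajectory_continuous[OF y]) (auto simp: less_imp_neq[symmetric])
  then obtain m where m: "m \<in> ?S" "\<And>r. r \<in> ?S \<Longrightarrow> e r \<le> e m"
    using continuous_attains_sup[of ?S e] compact_segment by auto
  have sub: "closed_segment s m \<subseteq> ?S"
    using m(1) by (simp add: closed_segment_subset)
  have e: "norm (x r - y r) = e r * \<alpha> r s" for r
    using alpha_pos[of r s] by (simp add: e_def)
  have C0: "C \<ge> 0"
    using order_trans[OF norm_ge_zero C[of s]] alpha_pos[of s s] by (simp add: zero_le_mult_iff)
  have em: "e m \<ge> 0" using alpha_pos[of m s] by (simp add: e_def)
  define B where "B = (2 * e m + C) * \<alpha> m s"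
  define G where "G r = T m 0 (T 0 r (x r - y r))" for r
  define \<Delta> where "\<Delta> r = forcing \<phi> x r - forcing \<psi> y r" for r
  have "norm (G m - G s) \<le> \<bar>B * center_primitive m - B * center_primitive s\<bar>"
  proof (rule norm_increment_segment)
    show "(G has_vector_derivative T m 0 (P 0 (T 0 r (\<Delta> r)))) (at r)" for r
      using x y unfolding G_def \<Delta>_def blinfun.diff_right center_trajectory_def
      by (intro has_vector_derivative_diff bounded_linear.has_vector_derivative[OF
            blinfun.bounded_linear_right]) auto
    show "((\<lambda>r. B * center_primitive r) has_vector_derivative
        B * (\<delta> * \<gamma> / 2 * exp (- \<gamma> * \<bar>r\<bar>))) (at r)" if "r \<noteq> 0" for r
      using center_primitive_derivative[OF that]
      by (intro bounded_linear.has_vector_derivative[OF bounded_linear_mult_right])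
    show "continuous_on (closed_segment s m) (\<lambda>r. B * center_primitive r)"
      unfolding center_primitive_def by (intro continuous_intros)
    fix r assume r: "r \<in> closed_segment s m" "r \<noteq> 0"
    have "T m 0 (P 0 (T 0 r (\<Delta> r))) = (T m r o\<^sub>L P r) (\<Delta> r)"
      by (simp add: P_T T_comp)
    then have "norm (T m 0 (P 0 (T 0 r (\<Delta> r)))) \<le> norm (T m r o\<^sub>L P r) * norm (\<Delta> r)"
      by (metis norm_blinfun)
    also have "\<dots> \<le> \<alpha> m r * (lip r * (2 * norm (x r - y r) + norm (\<phi> (r, y r) - \<psi> (r, y r))))"
      unfolding \<Delta>_def using alpha_pos[of m r]
      by (intro mult_mono norm_T_P forcing_diff(2) \<phi> r) (auto simp: center_trajectory_mem[OF x] center_trajectory_mem[OF y])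
    also have "\<dots> \<le> \<alpha> m r * (lip r * (2 * (e m * \<alpha> r s) + C * \<alpha> r s))"
      using m(2)[of r] r sub alpha_pos[of r s] alpha_pos[of m r] unfolding e
      by (intro mult_left_mono add_mono C mult_right_mono lip_nonneg) auto
    also have "\<dots> = (\<alpha> m r * \<alpha> r s) * lip r * (2 * e m + C)" by (simp add: algebra_simps)
    also have "\<dots> = D * exp (\<epsilon> * \<bar>r\<bar>) * lip r * B"
      unfolding alpha_mult[OF r(1)] B_def by (simp add: algebra_simps)
    also have "\<dots> \<le> \<delta> * \<gamma> / 2 * exp (- \<gamma> * \<bar>r\<bar>) * B"
      using em C0 alpha_pos[of m s] by (intro mult_right_mono lip_center) (auto simp: B_def)
    finally show "norm (T m 0 (P 0 (T 0 r (\<Delta> r)))) \<le> B * (\<delta> * \<gamma> / 2 * exp (- \<gamma> * \<bar>r\<bar>))"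
      by (simp add: mult_ac)
  qed
  also have "\<dots> = B * \<bar>center_primitive m - center_primitive s\<bar>"
    using em C0 alpha_pos[of m s] by (simp add: B_def abs_mult flip: right_diff_distrib)
  also have "\<dots> \<le> B * \<delta>"
    using em C0 alpha_pos[of m s] by (intro mult_left_mono center_primitive_bound) (simp add: B_def)
  finally have "norm (G m - G s) \<le> B * \<delta>" .
  moreover have "norm (G s) \<le> \<alpha> m s * norm (x s - y s)"
  proof -
    have "G s = (T m s o\<^sub>L P s) (x s - y s)"
      by (simp add: G_def T_comp blinfun.diff_right center_trajectory_mem[OF x] center_trajectory_mem[OF y])
    then show ?thesis
      by (metis norm_blinfun norm_T_P mult_right_mono norm_ge_zero order_trans)
  qed
  moreover have "G m = x m - y m" by (simp add: G_def T_comp T_refl)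
  ultimately have "norm (x m - y m) \<le> \<alpha> m s * norm (x s - y s) + B * \<delta>"
    using norm_triangle_ineq[of "G m - G s" "G s"] by simp
  then have "\<alpha> m s * e m \<le> \<alpha> m s * (norm (x s - y s) + (2 * e m + C) * \<delta>)"
    by (simp add: e B_def algebra_simps)
  then have "e m \<le> norm (x s - y s) + (2 * e m + C) * \<delta>"
    using alpha_pos[of m s] by simp
  moreover have "e m * \<delta> \<le> e m * (1 / 6)"
    using delta em by (intro mult_left_mono) auto
  ultimately have "e m \<le> 3 / 2 * (norm (x s - y s) + \<delta> * C)"
    by (simp add: algebra_simps)
  then have "e t \<le> 3 / 2 * (norm (x s - y s) + \<delta> * C)"
    using m(2)[of t] by simp
  then show ?thesis
    using alpha_pos[of t s] unfolding e by (intro mult_right_mono) auto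
qed

lemma center_trajectory_lipschitz:
  assumes "\<phi> \<in> slope_maps" "center_trajectory \<phi> x" "center_trajectory \<phi> y"
  shows "norm (x t - y t) \<le> 3 / 2 * norm (x s - y s) * \<alpha> t s"
  using center_trajectory_estimate[OF assms, of 0] by simp

lemma center_trajectory_norm:
  assumes "\<phi> \<in> slope_maps" "center_trajectory \<phi> x"
  shows "norm (x t) \<le> 3 / 2 * norm (x s) * \<alpha> t s"
  using center_trajectory_lipschitz[OF assms center_trajectory_zero[OF assms(1)]] by simp

lemma center_trajectory_unique:
  assumes "\<phi> \<in> slope_maps" "center_trajectory \<phi> x" "center_trajectory \<phi> y" "x s = y s"
  shows "x = y"
  using center_trajectory_lipschitz[OF assms(1-3), of _ s] assms(4) by auto

section \<open>Response of the complementary directions\<close>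

text \<open>A solution of \<open>y' = A(t) y + (Id - P\<^sub>t) h(t)\<close> in \<open>F\<^sup>+ \<oplus> F\<^sup>-\<close>, in the moving frame. The
  conditions at \<open>-\<infinity>\<close> and \<open>+\<infinity>\<close> say that it is
  \<open>\<integral>\<^bsub>-\<infinity>\<^esub>\<^bsup>t\<^esup> T\<^sub>t\<^sub>,\<^sub>r Q\<^sup>+\<^sub>r h(r) dr - \<integral>\<^bsub>t\<^esub>\<^bsup>\<infinity>\<^esup> T\<^sub>t\<^sub>,\<^sub>r Q\<^sup>-\<^sub>r h(r) dr\<close>
  without mentioning improper integrals.\<close>

definition fibre_response :: "(real \<Rightarrow> 'a) \<Rightarrow> (real \<Rightarrow> 'a) \<Rightarrow> bool" where
  "fibre_response h y \<longleftrightarrow>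
    (\<forall>t. P t (y t) = 0 \<and> ((\<lambda>t. T 0 t (y t)) has_vector_derivative
      (T 0 t (h t) - P 0 (T 0 t (h t)))) (at t)) \<and>
    ((\<lambda>t. Qp 0 (T 0 t (y t))) \<longlongrightarrow> 0) at_bot \<and> ((\<lambda>t. Qm 0 (T 0 t (y t))) \<longlongrightarrow> 0) at_top"

lemma fibre_response_diff:
  assumes "fibre_response h y" "fibre_response k z"
  shows "fibre_response (\<lambda>t. h t - k t) (\<lambda>t. y t - z t)"
proof -
  have 1: "((\<lambda>t. T 0 t (y t - z t)) has_vector_derivative
      (T 0 t (h t) - P 0 (T 0 t (h t))) - (T 0 t (k t) - P 0 (T 0 t (k t)))) (at t)" for t
    using assms unfolding fibre_response_def blinfun.diff_right
    by (intro has_vector_derivative_diff) auto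
  have 2: "((\<lambda>t. Qp 0 (T 0 t (y t - z t))) \<longlongrightarrow> 0 - 0) at_bot"
    "((\<lambda>t. Qm 0 (T 0 t (y t - z t))) \<longlongrightarrow> 0 - 0) at_top"
    using assms unfolding fibre_response_def blinfun.diff_right
    by (intro tendsto_diff; auto)+
  show ?thesis
    using 1 2 assms unfolding fibre_response_def
    by (auto simp: blinfun.diff_right algebra_simps)
qed

text \<open>The increments are transported to the fixed time \<open>s\<close>, where
  \<open>\<parallel>T\<^sub>s\<^sub>,\<^sub>r Q\<^sup>+\<^sub>r h(r)\<parallel> \<le> \<beta>\<^sup>+\<^sub>s\<^sub>,\<^sub>r \<parallel>h(r)\<parallel>\<close> is below \<open>K\<close> times the density.\<close>

lemma plus_increment:
  assumes Z: "\<And>r. (Z has_vector_derivative Qp 0 (T 0 r (h r))) (at r)" and "K \<ge> 0"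
    and h: "\<And>r. r \<noteq> 0 \<Longrightarrow> norm (h r) \<le> lip r * (K * \<alpha> r s)" and "u \<le> v" "v \<le> s"
  shows "norm (T s 0 (Z v) - T s 0 (Z u)) \<le> K * plus_primitive s v - K * plus_primitive s u"
proof (rule norm_increment_le[OF \<open>u \<le> v\<close>])
  have d: "((\<lambda>r. T s 0 (Z r)) has_vector_derivative T s 0 (Qp 0 (T 0 r (h r)))) (at r)" for r
    by (intro bounded_linear.has_vector_derivative[OF blinfun.bounded_linear_right] Z)
  then show "((\<lambda>r. T s 0 (Z r)) has_vector_derivative T s 0 (Qp 0 (T 0 r (h r)))) (at r)" for r .
  show "continuous_on {u..v} (\<lambda>r. T s 0 (Z r))"
    using d by (meson continuous_at_imp_continuous_on has_vector_derivative_continuous)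
  show "continuous_on {u..v} (\<lambda>r. K * plus_primitive s r)"
    by (intro continuous_intros continuous_primitives)
  show "((\<lambda>r. K * plus_primitive s r) has_vector_derivative K * plus_density s r) (at r)"
    if "r \<noteq> 0" for r
    by (intro bounded_linear.has_vector_derivative[OF bounded_linear_mult_right]
        plus_primitive_derivative that)
  fix r assume r: "u < r" "r < v" "r \<noteq> 0"
  have "r \<le> s" using r \<open>v \<le> s\<close> by simp
  have "T s 0 (Qp 0 (T 0 r (h r))) = (T s r o\<^sub>L Qp r) (h r)"
    by (simp add: Qp_T T_comp)
  also have "norm \<dots> \<le> \<beta>p s r * (lip r * (K * \<alpha> r s))"
    by (intro order_trans[OF norm_blinfun] mult_mono norm_T_Qp h r \<open>r \<le> s\<close>
        order_trans[OF norm_ge_zero norm_T_Qp]) auto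
  also have "\<dots> = K * (\<beta>p s r * lip r * \<alpha> r s)" by simp
  also have "\<dots> \<le> K * plus_density s r"
    using \<open>K \<ge> 0\<close> \<open>r \<le> s\<close> by (intro mult_left_mono plus_density_bound)
  finally show "norm (T s 0 (Qp 0 (T 0 r (h r)))) \<le> K * plus_density s r" .
qed

lemma minus_increment:
  assumes Z: "\<And>r. (Z has_vector_derivative Qm 0 (T 0 r (h r))) (at r)" and "K \<ge> 0"
    and h: "\<And>r. r \<noteq> 0 \<Longrightarrow> norm (h r) \<le> lip r * (K * \<alpha> r s)" and "s \<le> u" "u \<le> v"
  shows "norm (T s 0 (Z v) - T s 0 (Z u)) \<le> K * minus_primitive s v - K * minus_primitive s u"
proof (rule norm_increment_le[OF \<open>u \<le> v\<close>])
  have d: "((\<lambda>r. T s 0 (Z r)) has_vector_derivative T s 0 (Qm 0 (T 0 r (h r)))) (at r)" for r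
    by (intro bounded_linear.has_vector_derivative[OF blinfun.bounded_linear_right] Z)
  then show "((\<lambda>r. T s 0 (Z r)) has_vector_derivative T s 0 (Qm 0 (T 0 r (h r)))) (at r)" for r .
  show "continuous_on {u..v} (\<lambda>r. T s 0 (Z r))"
    using d by (meson continuous_at_imp_continuous_on has_vector_derivative_continuous)
  show "continuous_on {u..v} (\<lambda>r. K * minus_primitive s r)"
    by (intro continuous_intros continuous_primitives)
  show "((\<lambda>r. K * minus_primitive s r) has_vector_derivative K * minus_density s r) (at r)"
    if "r \<noteq> 0" for r
    by (intro bounded_linear.has_vector_derivative[OF bounded_linear_mult_right]
        minus_primitive_derivative that)
  fix r assume r: "u < r" "r < v" "r \<noteq> 0"
  have "s \<le> r" using r \<open>s \<le> u\<close> by simp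
  have "T s 0 (Qm 0 (T 0 r (h r))) = (T s r o\<^sub>L Qm r) (h r)"
    by (simp add: Qm_T T_comp)
  also have "norm \<dots> \<le> \<beta>m s r * (lip r * (K * \<alpha> r s))"
    by (intro order_trans[OF norm_blinfun] mult_mono norm_T_Qm h r \<open>s \<le> r\<close>
        order_trans[OF norm_ge_zero norm_T_Qm]) auto
  also have "\<dots> = K * (\<beta>m s r * lip r * \<alpha> r s)" by simp
  also have "\<dots> \<le> K * minus_density s r"
    using \<open>K \<ge> 0\<close> \<open>s \<le> r\<close> by (intro mult_left_mono minus_density_bound)
  finally show "norm (T s 0 (Qm 0 (T 0 r (h r)))) \<le> K * minus_density s r" .
qed

lemma fibre_response_components:
  assumes "fibre_response h y"
  shows "((\<lambda>r. Qp 0 (T 0 r (y r))) has_vector_derivative Qp 0 (T 0 r (h r))) (at r)"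
    and "((\<lambda>r. Qm 0 (T 0 r (y r))) has_vector_derivative Qm 0 (T 0 r (h r))) (at r)"
proof -
  have *: "((\<lambda>r. B (T 0 r (y r))) has_vector_derivative B (T 0 r (h r) - P 0 (T 0 r (h r)))) (at r)"
    for B :: "'a \<Rightarrow>\<^sub>L 'a"
    using assms unfolding fibre_response_def
    by (intro bounded_linear.has_vector_derivative[OF blinfun.bounded_linear_right]) auto
  show "((\<lambda>r. Qp 0 (T 0 r (y r))) has_vector_derivative Qp 0 (T 0 r (h r))) (at r)"
    "((\<lambda>r. Qm 0 (T 0 r (y r))) has_vector_derivative Qm 0 (T 0 r (h r))) (at r)"
    using *[of "Qp 0"] *[of "Qm 0"] by (simp_all add: blinfun.diff_right)
qed

text \<open>The stable part is the limit of its increments from \<open>u\<close> to \<open>s\<close> as \<open>u \<rightarrow> -\<infinity>\<close>, the unstable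
  part that of the increments from \<open>s\<close> to \<open>u\<close> as \<open>u \<rightarrow> \<infinity>\<close>; each contributes \<open>\<delta> K\<close>.\<close>

lemma fibre_response_bound:
  assumes y: "fibre_response h y" and K: "K \<ge> 0"
    and h: "\<And>r. r \<noteq> 0 \<Longrightarrow> norm (h r) \<le> lip r * (K * \<alpha> r s)"
  shows "norm (y s) \<le> 2 * \<delta> * K"
proof -
  define Yp where "Yp r = T s 0 (Qp 0 (T 0 r (y r)))" for r
  define Ym where "Ym r = T s 0 (Qm 0 (T 0 r (y r)))" for r
  have "((\<lambda>r. Yp s - Yp r) \<longlongrightarrow> Yp s - T s 0 0) at_bot"
    using y unfolding Yp_def fibre_response_def
    by (intro tendsto_diff tendsto_const blinfun.tendsto) auto
  moreover have "eventually (\<lambda>r. norm (Yp s - Yp r) \<le> K * \<delta>) at_bot"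
    unfolding eventually_at_bot_linorder
  proof (intro exI allI impI)
    fix u assume "u \<le> s"
    have "norm (Yp s - Yp u) \<le> K * plus_primitive s s - K * plus_primitive s u"
      unfolding Yp_def using \<open>u \<le> s\<close>
      by (intro plus_increment[OF fibre_response_components(1)[OF y] K h]) auto
    also have "\<dots> \<le> K * \<delta>" using K primitives_sign(1)[of s u] by simp
    finally show "norm (Yp s - Yp u) \<le> K * \<delta>" .
  qed
  ultimately have p: "norm (Yp s - T s 0 0) \<le> K * \<delta>"
    by (rule Lim_norm_ubound[rotated]) simp
  have "((\<lambda>r. Ym r - Ym s) \<longlongrightarrow> T s 0 0 - Ym s) at_top"
    using y unfolding Ym_def fibre_response_def
    by (intro tendsto_diff tendsto_const blinfun.tendsto) auto
  moreover have "eventually (\<lambda>r. norm (Ym r - Ym s) \<le> K * \<delta>) at_top"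
    unfolding eventually_at_top_linorder
  proof (intro exI allI impI)
    fix u assume "s \<le> u"
    have "norm (Ym u - Ym s) \<le> K * minus_primitive s u - K * minus_primitive s s"
      unfolding Ym_def using \<open>s \<le> u\<close>
      by (intro minus_increment[OF fibre_response_components(2)[OF y] K h]) auto
    also have "\<dots> \<le> K * \<delta>"
      using K primitives_sign(2)[of s u] by (simp add: mult_nonneg_nonpos)
    finally show "norm (Ym u - Ym s) \<le> K * \<delta>" .
  qed
  ultimately have m: "norm (T s 0 0 - Ym s) \<le> K * \<delta>"
    by (rule Lim_norm_ubound[rotated]) simp
  have "y s = Yp s + Ym s"
    using y sum_projections[of s "y s"]
    by (simp add: Yp_def Ym_def Qp_T Qm_T T_comp T_refl fibre_response_def)
  then have "norm (y s) \<le> norm (Yp s) + norm (Ym s)"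
    by (simp add: norm_triangle_ineq)
  then show ?thesis
    using p m by (simp add: blinfun.zero_right algebra_simps)
qed

lemma fibre_response_unique:
  assumes "fibre_response h y" "fibre_response h z"
  shows "y = z"
proof
  fix s
  show "y s = z s"
    using fibre_response_bound[OF fibre_response_diff[OF assms], of 0 s] by simp
qed

text \<open>The limits of the primitives at \<open>-\<infinity>\<close> and \<open>+\<infinity>\<close> are the constants of integration.\<close>

lemma fibre_response_exists:
  assumes cont: "continuous_on UNIV h" and K: "K \<ge> 0"
    and h: "\<And>r. r \<noteq> 0 \<Longrightarrow> norm (h r) \<le> lip r * (K * \<alpha> r s)"
  shows "\<exists>y. fibre_response h y"
proof -
  have ch: "continuous_on UNIV (\<lambda>r. B (T 0 r (h r)))" for B :: "'a \<Rightarrow>\<^sub>L 'a"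
    by (intro blinfun.continuous_on continuous_on_const continuous_backward cont)
  define Zp where "Zp = antiderivative (\<lambda>r. Qp 0 (T 0 r (h r)))"
  define Zm where "Zm = antiderivative (\<lambda>r. Qm 0 (T 0 r (h r)))"
  have dp: "(Zp has_vector_derivative Qp 0 (T 0 r (h r))) (at r)"
    and dm: "(Zm has_vector_derivative Qm 0 (T 0 r (h r))) (at r)" for r
    unfolding Zp_def Zm_def by (rule antiderivative_has_derivative[OF ch])+
  have cancel: "T 0 s (T s 0 w) = w" for w by (simp add: T_comp T_refl)
  obtain lp1 where "((\<lambda>r. T s 0 (Zp r)) \<longlongrightarrow> lp1) at_bot"
    using limit_at_bot_if_dominated[OF plus_increment[OF dp K h]
        tendsto_mult[OF tendsto_const[of K] plus_primitive_at_bot]] by blast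
  then have "((\<lambda>r. T 0 s (T s 0 (Zp r))) \<longlongrightarrow> T 0 s lp1) at_bot"
    by (intro blinfun.tendsto tendsto_const)
  then obtain lp where lp: "(Zp \<longlongrightarrow> lp) at_bot" unfolding cancel by blast
  obtain lm1 where "((\<lambda>r. T s 0 (Zm r)) \<longlongrightarrow> lm1) at_top"
    using limit_at_top_if_dominated[OF minus_increment[OF dm K h]
        tendsto_mult[OF tendsto_const[of K] minus_primitive_at_top]] by blast
  then have "((\<lambda>r. T 0 s (T s 0 (Zm r))) \<longlongrightarrow> T 0 s lm1) at_top"
    by (intro blinfun.tendsto tendsto_const)
  then obtain lm where lm: "(Zm \<longlongrightarrow> lm) at_top" unfolding cancel by blast
  define y where "y t = T t 0 (Qp 0 (Zp t - lp) + Qm 0 (Zm t - lm))" for t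
  have Ty: "T 0 t (y t) = Qp 0 (Zp t - lp) + Qm 0 (Zm t - lm)" for t
    by (simp add: y_def T_comp T_refl)
  have "P t (y t) = 0" for t
    by (simp add: y_def P_T blinfun.add_right blinfun.zero_right)
  moreover have "((\<lambda>t. T 0 t (y t)) has_vector_derivative
      T 0 t (h t) - P 0 (T 0 t (h t))) (at t)" for t
  proof -
    have "((\<lambda>t. Qp 0 (Zp t - lp) + Qm 0 (Zm t - lm)) has_vector_derivative
        Qp 0 (Qp 0 (T 0 t (h t)) - 0) + Qm 0 (Qm 0 (T 0 t (h t)) - 0)) (at t)"
      by (intro has_vector_derivative_add has_vector_derivative_diff has_vector_derivative_const
          bounded_linear.has_vector_derivative[OF blinfun.bounded_linear_right] dp dm)
    moreover have "Qp 0 w + Qm 0 w = w - P 0 w" for w by (simp add: Qm_eq)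
    ultimately show ?thesis unfolding Ty by simp
  qed
  moreover have "((\<lambda>t. Qp 0 (T 0 t (y t))) \<longlongrightarrow> Qp 0 (lp - lp)) at_bot"
    "((\<lambda>t. Qm 0 (T 0 t (y t))) \<longlongrightarrow> Qm 0 (lm - lm)) at_top"
    unfolding Ty blinfun.add_right Qp_Qp Qm_Qm Qp_Qm Qm_Qp add_0_right add_0_left
    by (intro blinfun.tendsto tendsto_diff tendsto_const lp lm)+
  ultimately show ?thesis
    unfolding fibre_response_def by (auto simp: blinfun.zero_right)
qed

section \<open>The graph transform\<close>

definition graph_transform :: "(real \<times> 'a \<Rightarrow> 'a) \<Rightarrow> real \<times> 'a \<Rightarrow> 'a" where
  "graph_transform \<phi> = (\<lambda>(s, \<xi>). if P s \<xi> = \<xi>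
    then THE w. \<exists>x y. center_trajectory \<phi> x \<and> x s = \<xi> \<and> fibre_response (forcing \<phi> x) y \<and> w = y s
    else undefined)"

lemma forcing_bound:
  assumes \<phi>: "\<phi> \<in> slope_maps" and x: "center_trajectory \<phi> x" and r: "r \<noteq> 0"
  shows "norm (forcing \<phi> x r) \<le> lip r * (3 * norm (x s) * \<alpha> r s)"
proof -
  have "norm (forcing \<phi> x r - forcing \<phi> (\<lambda>_. 0) r) \<le> lip r * (2 * norm (x r - 0) + norm (\<phi> (r, 0) - \<phi> (r, 0)))"
    using r by (intro forcing_diff(2)[OF \<phi>])
      (auto simp: center_trajectory_mem[OF x] blinfun.zero_right)
  also have "\<dots> = lip r * (2 * norm (x r))" by simp
  also have "\<dots> \<le> lip r * (2 * (3 / 2 * norm (x s) * \<alpha> r s))"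
    by (intro mult_left_mono center_trajectory_norm[OF \<phi> x] lip_nonneg) simp
  finally show ?thesis
    using slope_mapsD(2)[OF \<phi>] by (simp add: forcing_def f_zero)
qed

lemma lifted_trajectory_exists:
  assumes \<phi>: "\<phi> \<in> slope_maps" and \<xi>: "P s \<xi> = \<xi>"
  obtains x y where "center_trajectory \<phi> x" "x s = \<xi>" "fibre_response (forcing \<phi> x) y"
proof -
  obtain x where x: "center_trajectory \<phi> x" "x s = \<xi>"
    using center_trajectory_exists[OF assms] by blast
  have "\<exists>y. fibre_response (forcing \<phi> x) y"
    by (rule fibre_response_exists[OF forcing_continuous[OF \<phi> x(1)] _ forcing_bound[OF \<phi> x(1)]]) simp
  then show ?thesis using x that by blast
qed

text \<open>One pair \<open>(x, y)\<close> yields the value of the transform at every time along \<open>x\<close>, since the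
  conditions on \<open>y\<close> do not refer to a base time. This is what turns a fixed point into an
  invariant graph.\<close>

lemma graph_transform_eq:
  assumes \<phi>: "\<phi> \<in> slope_maps" and x: "center_trajectory \<phi> x"
    and y: "fibre_response (forcing \<phi> x) y"
  shows "graph_transform \<phi> (t, x t) = y t"
proof -
  have "(THE v. \<exists>w z. center_trajectory \<phi> w \<and> w t = x t \<and> fibre_response (forcing \<phi> w) z \<and> v = z t) = y t"
  proof (rule the_equality)
    show "\<exists>w z. center_trajectory \<phi> w \<and> w t = x t \<and> fibre_response (forcing \<phi> w) z \<and> y t = z t"
      using x y by blast
    fix v assume "\<exists>w z. center_trajectory \<phi> w \<and> w t = x t \<and> fibre_response (forcing \<phi> w) z \<and> v = z t"
    then obtain w z where w: "center_trajectory \<phi> w" "w t = x t"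
      and z: "fibre_response (forcing \<phi> w) z" "v = z t" by blast
    have "w = x" by (rule center_trajectory_unique[OF \<phi> w(1) x w(2)])
    then show "v = y t" using z y fibre_response_unique by blast
  qed
  then show ?thesis
    by (simp add: graph_transform_def center_trajectory_mem[OF x])
qed

text \<open>The forcing terms differ by at most \<open>Lip(f\<^sub>r) \<cdot> 2 \<cdot> 3/2 \<cdot> \<alpha>\<^sub>r\<^sub>,\<^sub>s \<parallel>\<xi> - \<xi>'\<parallel>\<close>, and the response
  multiplies this by \<open>2\<delta>\<close>.\<close>

lemma graph_transform_lipschitz:
  assumes \<phi>: "\<phi> \<in> slope_maps" and \<xi>: "P s \<xi> = \<xi>" "P s \<xi>' = \<xi>'"
  shows "norm (graph_transform \<phi> (s, \<xi>) - graph_transform \<phi> (s, \<xi>')) \<le> slope * norm (\<xi> - \<xi>')"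
proof -
  obtain x y where x: "center_trajectory \<phi> x" "x s = \<xi>" and y: "fibre_response (forcing \<phi> x) y"
    using lifted_trajectory_exists[OF \<phi> \<xi>(1)] .
  obtain x' y' where x': "center_trajectory \<phi> x'" "x' s = \<xi>'" and y': "fibre_response (forcing \<phi> x') y'"
    using lifted_trajectory_exists[OF \<phi> \<xi>(2)] .
  have "norm (y s - y' s) \<le> 2 * \<delta> * (3 * norm (\<xi> - \<xi>'))"
  proof (rule fibre_response_bound[OF fibre_response_diff[OF y y']])
    fix r :: real assume "r \<noteq> 0"
    have "norm (forcing \<phi> x r - forcing \<phi> x' r) \<le> lip r * (2 * norm (x r - x' r) + norm (\<phi> (r, x' r) - \<phi> (r, x' r)))"
      using \<open>r \<noteq> 0\<close> by (intro forcing_diff(2)[OF \<phi>] center_trajectory_mem[OF x(1)] center_trajectory_mem[OF x'(1)])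
    also have "\<dots> \<le> lip r * (2 * (3 / 2 * norm (x s - x' s) * \<alpha> r s) + 0)"
      by (intro mult_left_mono add_mono center_trajectory_lipschitz[OF \<phi> x(1) x'(1)] lip_nonneg) auto
    finally show "norm (forcing \<phi> x r - forcing \<phi> x' r) \<le> lip r * (3 * norm (\<xi> - \<xi>') * \<alpha> r s)"
      by (simp add: x x')
  qed simp
  then show ?thesis
    using graph_transform_eq[OF \<phi> x(1) y, of s] graph_transform_eq[OF \<phi> x'(1) y', of s]
    by (simp add: x x')
qed

text \<open>The maps differ along the trajectory by at most \<open>C \<alpha>\<^sub>r\<^sub>,\<^sub>s\<close> with \<open>C = 3/2 \<kappa> \<parallel>\<xi>\<parallel>\<close>. The
  trajectories themselves then differ by \<open>3/2 \<delta> C \<alpha>\<^sub>r\<^sub>,\<^sub>s\<close>, so the forcing terms differ by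
  \<open>(3\<delta> + 1) C \<le> 3/2 C\<close> relative to \<open>Lip(f\<^sub>r) \<alpha>\<^sub>r\<^sub>,\<^sub>s\<close>, and \<open>2\<delta> \<cdot> 3/2 \<cdot> C \<le> C/2 = 3/4 \<kappa> \<parallel>\<xi>\<parallel>\<close>.\<close>

lemma graph_transform_contraction:
  assumes \<phi>: "\<phi> \<in> slope_maps" and \<psi>: "\<psi> \<in> slope_maps" and \<kappa>: "\<kappa> \<ge> 0"
    and close: "\<And>t \<xi>. P t \<xi> = \<xi> \<Longrightarrow> norm (\<phi> (t, \<xi>) - \<psi> (t, \<xi>)) \<le> \<kappa> * norm \<xi>"
    and \<xi>: "P s \<xi> = \<xi>"
  shows "norm (graph_transform \<phi> (s, \<xi>) - graph_transform \<psi> (s, \<xi>)) \<le> 3 / 4 * \<kappa> * norm \<xi>"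
proof -
  obtain x y where x: "center_trajectory \<phi> x" "x s = \<xi>" and y: "fibre_response (forcing \<phi> x) y"
    using lifted_trajectory_exists[OF \<phi> \<xi>] .
  obtain x' y' where x': "center_trajectory \<psi> x'" "x' s = \<xi>" and y': "fibre_response (forcing \<psi> x') y'"
    using lifted_trajectory_exists[OF \<psi> \<xi>] .
  define C where "C = 3 / 2 * \<kappa> * norm \<xi>"
  have C0: "C \<ge> 0" using \<kappa> by (simp add: C_def)
  have close': "norm (\<phi> (r, x' r) - \<psi> (r, x' r)) \<le> C * \<alpha> r s" for r
  proof -
    have "norm (\<phi> (r, x' r) - \<psi> (r, x' r)) \<le> \<kappa> * norm (x' r)"
      by (intro close center_trajectory_mem[OF x'(1)])
    also have "\<dots> \<le> \<kappa> * (3 / 2 * norm (x' s) * \<alpha> r s)"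
      by (intro mult_left_mono center_trajectory_norm[OF \<psi> x'(1)] \<kappa>)
    finally show ?thesis by (simp add: C_def x' mult_ac)
  qed
  have "norm (y s - y' s) \<le> 2 * \<delta> * (3 / 2 * C)"
  proof (rule fibre_response_bound[OF fibre_response_diff[OF y y']])
    fix r :: real assume "r \<noteq> 0"
    have "norm (forcing \<phi> x r - forcing \<psi> x' r) \<le> lip r * (2 * norm (x r - x' r) + norm (\<phi> (r, x' r) - \<psi> (r, x' r)))"
      using \<open>r \<noteq> 0\<close> by (intro forcing_diff(2)[OF \<phi>] center_trajectory_mem[OF x(1)] center_trajectory_mem[OF x'(1)])
    also have "\<dots> \<le> lip r * (2 * (3 / 2 * (norm (x s - x' s) + \<delta> * C) * \<alpha> r s) + C * \<alpha> r s)"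
      by (intro mult_left_mono add_mono center_trajectory_estimate[OF \<phi> x(1) x'(1)] close' lip_nonneg) auto
    also have "\<dots> = lip r * ((3 * \<delta> + 1) * C * \<alpha> r s)"
      by (simp add: x x' algebra_simps)
    also have "\<dots> \<le> lip r * (3 / 2 * C * \<alpha> r s)"
      using delta C0 alpha_pos[of r s] by (intro mult_left_mono mult_right_mono lip_nonneg) auto
    finally show "norm (forcing \<phi> x r - forcing \<psi> x' r) \<le> lip r * (3 / 2 * C * \<alpha> r s)" .
  qed (use C0 in simp)
  also have "\<dots> \<le> 1 / 2 * C"
    using mult_right_mono[of "3 * \<delta>" "1 / 2" C] delta C0 by (simp add: mult_ac)
  finally show ?thesis
    using graph_transform_eq[OF \<phi> x(1) y, of s] graph_transform_eq[OF \<psi> x'(1) y', of s]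
    by (simp add: x x' C_def)
qed

lemma alpha_locally_bounded:
  assumes "\<bar>s - s0\<bar> \<le> 1" "\<bar>r - s0\<bar> \<le> 1"
  shows "\<alpha> r s \<le> D * exp (2 * (\<bar>a\<bar> + \<bar>c\<bar>) + \<epsilon> * (\<bar>s0\<bar> + 1))"
proof -
  have *: "k * (x - y) \<le> \<bar>k\<bar> * 2" if "\<bar>x - y\<bar> \<le> 2" for k x y :: real
    using mult_left_mono[OF that, of "\<bar>k\<bar>"] abs_ge_self[of "k * (x - y)"]
    by (simp add: abs_mult)
  have "a * (r - s) \<le> 2 * (\<bar>a\<bar> + \<bar>c\<bar>)" "c * (s - r) \<le> 2 * (\<bar>a\<bar> + \<bar>c\<bar>)"
    by (rule order_trans[OF *], use assms in linarith, simp)+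
  moreover have "\<epsilon> * \<bar>s\<bar> \<le> \<epsilon> * (\<bar>s0\<bar> + 1)"
    using assms eps by (intro mult_left_mono) auto
  ultimately have "a * (r - s) + \<epsilon> * \<bar>s\<bar> \<le> 2 * (\<bar>a\<bar> + \<bar>c\<bar>) + \<epsilon> * (\<bar>s0\<bar> + 1)"
    "c * (s - r) + \<epsilon> * \<bar>s\<bar> \<le> 2 * (\<bar>a\<bar> + \<bar>c\<bar>) + \<epsilon> * (\<bar>s0\<bar> + 1)"
    by (auto intro: add_mono)
  then show ?thesis
    using D by (simp add: exp_alpha_def)
qed

text \<open>Continuity across fibres is obtained from the flow, not from the improper integrals. The pair
  \<open>(x, y)\<close> through \<open>(s, \<xi>)\<close> moves little between the times \<open>s\<close> and \<open>s0\<close>, and at time \<open>s0\<close> both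
  \<open>y(s0)\<close> and the value at \<open>\<xi>0\<close> belong to the same fibre, where the transform is Lipschitz.\<close>

lemma graph_transform_locally_controlled:
  assumes \<phi>: "\<phi> \<in> slope_maps" and \<xi>0: "P s0 \<xi>0 = \<xi>0"
  obtains C where "\<And>s \<xi>. P s \<xi> = \<xi> \<Longrightarrow> \<bar>s - s0\<bar> \<le> 1 \<Longrightarrow> norm \<xi> \<le> norm \<xi>0 + 1 \<Longrightarrow>
    norm (T 0 s (graph_transform \<phi> (s, \<xi>)) - T 0 s0 (graph_transform \<phi> (s0, \<xi>0)))
    \<le> C * (\<bar>s - s0\<bar> + norm (T 0 s \<xi> - T 0 s0 \<xi>0))"
proof -
  have "bounded ((\<lambda>r. T 0 r) ` cball s0 1)"
    by (intro compact_imp_bounded compact_continuous_image continuous_backward compact_cball)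
  then obtain B where B: "B > 0" "\<And>r. \<bar>r - s0\<bar> \<le> 1 \<Longrightarrow> norm (T 0 r) \<le> B"
    unfolding bounded_pos by (auto simp: dist_real_def abs_minus_commute)
  define H where "H = uniform_lip * (3 * (norm \<xi>0 + 1) * (D * exp (2 * (\<bar>a\<bar> + \<bar>c\<bar>) + \<epsilon> * (\<bar>s0\<bar> + 1))))"
  have H0: "H \<ge> 0" using uniform_lip_nonneg D by (simp add: H_def)
  define C1 where "C1 = norm (P 0) * (B * H)"
  define C2 where "C2 = B * H + norm (P 0) * (B * H)"
  have C12: "C1 \<ge> 0" "C2 \<ge> 0" using B H0 by (simp_all add: C1_def C2_def)
  define Ts where "Ts = norm (T s0 0)"
  define C where "C = C2 + B * (Ts * (C1 + 1))"
  show thesis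
  proof (rule that)
    fix s \<xi> assume \<xi>: "P s \<xi> = \<xi>" and s: "\<bar>s - s0\<bar> \<le> 1" and n\<xi>: "norm \<xi> \<le> norm \<xi>0 + 1"
    obtain x y where x: "center_trajectory \<phi> x" "x s = \<xi>" and y: "fibre_response (forcing \<phi> x) y"
      using lifted_trajectory_exists[OF \<phi> \<xi>] .
    have h: "norm (T 0 r (forcing \<phi> x r)) \<le> B * H" if "r \<in> closed_segment s0 s" for r
    proof -
      have r: "\<bar>r - s0\<bar> \<le> 1" using that s by (auto simp: closed_segment_eq_real_ivl split: if_splits)
      have "norm (x r) \<le> 3 / 2 * norm (x s) * \<alpha> r s"
        by (rule center_trajectory_norm[OF \<phi> x(1)])
      also have "\<dots> \<le> 3 / 2 * (norm \<xi>0 + 1) * (D * exp (2 * (\<bar>a\<bar> + \<bar>c\<bar>) + \<epsilon> * (\<bar>s0\<bar> + 1)))"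
        using n\<xi> alpha_pos[of r s] by (intro mult_mono alpha_locally_bounded s r) (auto simp: x)
      finally have nx: "norm (x r) \<le> 3 / 2 * (norm \<xi>0 + 1) * (D * exp (2 * (\<bar>a\<bar> + \<bar>c\<bar>) + \<epsilon> * (\<bar>s0\<bar> + 1)))" .
      have "norm ((x r + \<phi> (r, x r)) - ((\<lambda>_. 0) r + \<phi> (r, (\<lambda>_. 0) r)))
          \<le> 2 * norm (x r - (\<lambda>_. 0) r) + norm (\<phi> (r, (\<lambda>_. 0) r) - \<phi> (r, (\<lambda>_. 0) r))"
        by (intro forcing_diff(1)[OF \<phi>]) (auto simp: center_trajectory_mem[OF x(1)] blinfun.zero_right)
      then have "norm (x r + \<phi> (r, x r)) \<le> 2 * norm (x r)"
        by (simp add: slope_mapsD(2)[OF \<phi>])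
      then have "uniform_lip * norm (x r + \<phi> (r, x r)) \<le> H"
        using nx uniform_lip_nonneg unfolding H_def by (intro mult_left_mono) auto
      then have "norm (forcing \<phi> x r) \<le> H"
        unfolding forcing_def using f_norm_le order_trans by blast
      then show ?thesis
        using B r by (intro order_trans[OF norm_blinfun] mult_mono) auto
    qed
    have "norm (T 0 s (x s) - T 0 s0 (x s0)) \<le> C1 * \<bar>s - s0\<bar>"
    proof (rule norm_increment_le_bound[OF _ C12(1)])
      show "((\<lambda>r. T 0 r (x r)) has_vector_derivative P 0 (T 0 r (forcing \<phi> x r))) (at r)" for r
        using x(1) by (simp add: center_trajectory_def)
      show "norm (P 0 (T 0 r (forcing \<phi> x r))) \<le> C1" if "r \<in> closed_segment s0 s" for r
        unfolding C1_def by (rule order_trans[OF norm_blinfun]) (intro mult_left_mono h that norm_ge_zero)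
    qed
    then have 1: "norm (T 0 s0 (x s0) - T 0 s0 \<xi>0) \<le> C1 * \<bar>s - s0\<bar> + norm (T 0 s \<xi> - T 0 s0 \<xi>0)"
      using norm_triangle_ineq[of "T 0 s0 (x s0) - T 0 s \<xi>" "T 0 s \<xi> - T 0 s0 \<xi>0"]
      by (simp add: x norm_minus_commute)
    have 2: "norm (T 0 s (y s) - T 0 s0 (y s0)) \<le> C2 * \<bar>s - s0\<bar>"
    proof (rule norm_increment_le_bound[OF _ C12(2)])
      show "((\<lambda>r. T 0 r (y r)) has_vector_derivative
          T 0 r (forcing \<phi> x r) - P 0 (T 0 r (forcing \<phi> x r))) (at r)" for r
        using y by (simp add: fibre_response_def)
      show "norm (T 0 r (forcing \<phi> x r) - P 0 (T 0 r (forcing \<phi> x r))) \<le> C2"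
        if "r \<in> closed_segment s0 s" for r
      proof -
        have "norm (P 0 (T 0 r (forcing \<phi> x r))) \<le> norm (P 0) * (B * H)"
          by (rule order_trans[OF norm_blinfun]) (intro mult_left_mono h that norm_ge_zero)
        then show ?thesis
          unfolding C2_def using h[OF that] by (intro order_trans[OF norm_triangle_ineq4] add_mono)
      qed
    qed
    have 3: "norm (x s0 - \<xi>0) \<le> Ts * (C1 * \<bar>s - s0\<bar> + norm (T 0 s \<xi> - T 0 s0 \<xi>0))"
    proof -
      have "x s0 - \<xi>0 = T s0 0 (T 0 s0 (x s0) - T 0 s0 \<xi>0)"
        by (simp add: blinfun.diff_right T_comp T_refl)
      then have "norm (x s0 - \<xi>0) \<le> Ts * norm (T 0 s0 (x s0) - T 0 s0 \<xi>0)"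
        unfolding Ts_def by (metis norm_blinfun)
      also have "\<dots> \<le> Ts * (C1 * \<bar>s - s0\<bar> + norm (T 0 s \<xi> - T 0 s0 \<xi>0))"
        using 1 by (intro mult_left_mono) (auto simp: Ts_def)
      finally show ?thesis .
    qed
    have eq: "graph_transform \<phi> (s, \<xi>) = y s" "graph_transform \<phi> (s0, x s0) = y s0"
      using graph_transform_eq[OF \<phi> x(1) y] x(2) by auto
    have "norm (T 0 s0 (y s0) - T 0 s0 (graph_transform \<phi> (s0, \<xi>0))) \<le> B * norm (x s0 - \<xi>0)"
    proof -
      have "norm (y s0 - graph_transform \<phi> (s0, \<xi>0)) \<le> slope * norm (x s0 - \<xi>0)"
        unfolding eq(2)[symmetric]
        by (intro graph_transform_lipschitz[OF \<phi>] center_trajectory_mem[OF x(1)] \<xi>0)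
      also have "\<dots> \<le> 1 * norm (x s0 - \<xi>0)"
        using slope_range by (intro mult_right_mono) auto
      finally have "norm (y s0 - graph_transform \<phi> (s0, \<xi>0)) \<le> norm (x s0 - \<xi>0)" by simp
      then show ?thesis
        using B(1) B(2)[of s0] unfolding blinfun.diff_right[symmetric]
        by (intro order_trans[OF norm_blinfun] mult_mono) auto
    qed
    also have "\<dots> \<le> B * (Ts * (C1 * \<bar>s - s0\<bar> + norm (T 0 s \<xi> - T 0 s0 \<xi>0)))"
      using B(1) 3 by (intro mult_left_mono) auto
    finally have 4: "norm (T 0 s0 (y s0) - T 0 s0 (graph_transform \<phi> (s0, \<xi>0)))
        \<le> B * (Ts * (C1 * \<bar>s - s0\<bar> + norm (T 0 s \<xi> - T 0 s0 \<xi>0)))" .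
    have "norm (T 0 s (y s) - T 0 s0 (graph_transform \<phi> (s0, \<xi>0)))
        \<le> C2 * \<bar>s - s0\<bar> + B * (Ts * (C1 * \<bar>s - s0\<bar> + norm (T 0 s \<xi> - T 0 s0 \<xi>0)))"
      using norm_triangle_ineq[of "T 0 s (y s) - T 0 s0 (y s0)" "T 0 s0 (y s0) - T 0 s0 (graph_transform \<phi> (s0, \<xi>0))"]
        2 4 by simp
    also have "\<dots> \<le> C * (\<bar>s - s0\<bar> + norm (T 0 s \<xi> - T 0 s0 \<xi>0))"
    proof -
      define p where "p = norm (T 0 s \<xi> - T 0 s0 \<xi>0)"
      define q where "q = \<bar>s - s0\<bar>"
      have "p \<ge> 0" "q \<ge> 0" by (simp_all add: p_def q_def)
      then have "0 \<le> C2 * p" "0 \<le> B * Ts * (q + C1 * p)"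
        using C12 B(1) by (simp_all add: Ts_def)
      then show ?thesis
        unfolding p_def[symmetric] q_def[symmetric] by (simp add: C_def algebra_simps)
    qed
    finally show "norm (T 0 s (graph_transform \<phi> (s, \<xi>)) - T 0 s0 (graph_transform \<phi> (s0, \<xi>0)))
        \<le> C * (\<bar>s - s0\<bar> + norm (T 0 s \<xi> - T 0 s0 \<xi>0))"
      by (simp add: eq)
  qed
qed

lemma continuous_backward_snd: "continuous_on X (\<lambda>p. T 0 (fst p) (snd p))"
  by (rule blinfun.continuous_on[OF continuous_on_compose2[OF continuous_backward[of UNIV]
        continuous_on_fst[OF continuous_on_id]] continuous_on_snd[OF continuous_on_id]]) simp

lemma graph_transform_continuous:
  assumes \<phi>: "\<phi> \<in> slope_maps"
  shows "continuous_on (center_bundle P) (graph_transform \<phi>)"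
proof -
  let ?G = "center_bundle P"
  have "continuous_on ?G (\<lambda>p. T 0 (fst p) (graph_transform \<phi> p))"
    unfolding continuous_on_def
  proof
    fix p0 assume p0: "p0 \<in> ?G"
    obtain s0 \<xi>0 where p0_eq: "p0 = (s0, \<xi>0)" by (cases p0)
    have \<xi>0: "P s0 \<xi>0 = \<xi>0" using p0 by (simp add: p0_eq mem_center_bundle)
    obtain C where C: "\<And>s \<xi>. P s \<xi> = \<xi> \<Longrightarrow> \<bar>s - s0\<bar> \<le> 1 \<Longrightarrow> norm \<xi> \<le> norm \<xi>0 + 1 \<Longrightarrow>
        norm (T 0 s (graph_transform \<phi> (s, \<xi>)) - T 0 s0 (graph_transform \<phi> (s0, \<xi>0)))
        \<le> C * (\<bar>s - s0\<bar> + norm (T 0 s \<xi> - T 0 s0 \<xi>0))"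
      using graph_transform_locally_controlled[OF \<phi> \<xi>0] by metis
    let ?bound = "\<lambda>p. C * (\<bar>fst p - s0\<bar> + norm (T 0 (fst p) (snd p) - T 0 s0 \<xi>0))"
    have "continuous_on UNIV ?bound"
      by (intro continuous_on_mult continuous_on_const continuous_on_add continuous_on_norm
          continuous_on_diff continuous_backward_snd continuous_on_rabs continuous_on_fst continuous_on_id)
    then have "(?bound \<longlongrightarrow> ?bound p0) (at p0 within ?G)"
      by (meson UNIV_I continuous_on_def continuous_on_subset tendsto_within_subset subset_UNIV)
    then have lim: "(?bound \<longlongrightarrow> 0) (at p0 within ?G)" by (simp add: p0_eq)
    have "eventually (\<lambda>p. p \<in> ?G \<and> dist p p0 < 1) (at p0 within ?G)"
      unfolding eventually_at by (intro exI[of _ 1]) auto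
    then have "eventually (\<lambda>p. norm (T 0 (fst p) (graph_transform \<phi> p)
        - T 0 (fst p0) (graph_transform \<phi> p0)) \<le> ?bound p) (at p0 within ?G)"
    proof eventually_elim
      case (elim p)
      obtain s \<xi> where p: "p = (s, \<xi>)" by (cases p)
      have "\<bar>s - s0\<bar> \<le> 1" "norm (\<xi> - \<xi>0) \<le> 1"
        using elim dist_fst_le[of p p0] dist_snd_le[of p p0]
        by (simp_all add: p p0_eq dist_norm)
      then show ?case
        using C[of s \<xi>] elim norm_triangle_ineq2[of \<xi> \<xi>0]
        by (simp add: p p0_eq mem_center_bundle)
    qed
    from Lim_null_comparison[OF this lim]
    show "((\<lambda>p. T 0 (fst p) (graph_transform \<phi> p)) \<longlongrightarrow> T 0 (fst p0) (graph_transform \<phi> p0)) (at p0 within ?G)"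
      by (simp add: Lim_null[symmetric])
  qed
  moreover have "continuous_on ?G (\<lambda>p. T (fst p) 0)"
    by (rule continuous_on_compose2[OF continuous_forward[of UNIV]
        continuous_on_fst[OF continuous_on_id]]) simp
  ultimately have "continuous_on ?G (\<lambda>p. T (fst p) 0 (T 0 (fst p) (graph_transform \<phi> p)))"
    by (rule blinfun.continuous_on[rotated])
  then show ?thesis by (simp add: T_comp T_refl)
qed

lemma graph_transform_maps:
  assumes \<phi>: "\<phi> \<in> slope_maps"
  shows "graph_transform \<phi> \<in> slope_maps"
proof -
  have 0: "graph_transform \<phi> (t, 0) = 0" for t
  proof -
    have "fibre_response (forcing \<phi> (\<lambda>_. 0)) (\<lambda>_. 0)"
      by (simp add: fibre_response_def forcing_def f_zero slope_mapsD(2)[OF \<phi>] blinfun.zero_right)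
    from graph_transform_eq[OF \<phi> center_trajectory_zero[OF \<phi>] this] show ?thesis .
  qed
  have P: "P t (graph_transform \<phi> (t, \<xi>)) = 0" if \<xi>: "P t \<xi> = \<xi>" for t \<xi>
  proof -
    obtain x y where x: "center_trajectory \<phi> x" "x t = \<xi>" and y: "fibre_response (forcing \<phi> x) y"
      using lifted_trajectory_exists[OF \<phi> \<xi>] .
    have "graph_transform \<phi> (t, \<xi>) = y t"
      using graph_transform_eq[OF \<phi> x(1) y, of t] by (simp add: x)
    then show ?thesis using y by (simp add: fibre_response_def)
  qed
  have "graph_transform \<phi> \<in> extensional (center_bundle P)"
    by (auto simp: extensional_def graph_transform_def mem_center_bundle)
  then show ?thesis
    unfolding graph_maps_iff
    using 0 P graph_transform_continuous[OF \<phi>] graph_transform_lipschitz[OF \<phi>] by blast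
qed

section \<open>Fixed points of the graph transform\<close>

lemma iterate_maps: "\<phi> \<in> slope_maps \<Longrightarrow> (graph_transform ^^ n) \<phi> \<in> slope_maps"
  by (induction n) (simp_all add: graph_transform_maps)

text \<open>Two maps of slope at most \<open>1\<close> that vanish on the zero section are at distance at most
  \<open>2 \<parallel>\<xi>\<parallel>\<close>. Applied to \<open>\<phi>\<close> and an iterate of \<open>\<phi>\<close> this makes the iterates a Cauchy sequence;
  applied to two fixed points it shows that they agree.\<close>

lemma iterates_close:
  assumes \<phi>: "\<phi> \<in> slope_maps" and \<psi>: "\<psi> \<in> slope_maps" and \<xi>: "P t \<xi> = \<xi>"
  shows "norm ((graph_transform ^^ n) \<phi> (t, \<xi>) - (graph_transform ^^ n) \<psi> (t, \<xi>)) \<le> 2 * (3 / 4) ^ n * norm \<xi>"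
  using \<xi>
proof (induction n arbitrary: t \<xi>)
  case 0
  have "norm (\<phi> (t, \<xi>)) \<le> 1 * norm \<xi>"
    by (rule order_trans[OF slope_mapsD(5)[OF \<phi> 0] mult_right_mono]) (use slope_range in simp_all)
  moreover have "norm (\<psi> (t, \<xi>)) \<le> 1 * norm \<xi>"
    by (rule order_trans[OF slope_mapsD(5)[OF \<psi> 0] mult_right_mono]) (use slope_range in simp_all)
  ultimately show ?case using norm_triangle_ineq4[of "\<phi> (t, \<xi>)" "\<psi> (t, \<xi>)"] by simp
next
  case (Suc n)
  have "norm (graph_transform ((graph_transform ^^ n) \<phi>) (t, \<xi>) - graph_transform ((graph_transform ^^ n) \<psi>) (t, \<xi>))
      \<le> 3 / 4 * (2 * (3 / 4) ^ n) * norm \<xi>"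
    by (rule graph_transform_contraction) (use Suc iterate_maps \<phi> \<psi> in auto)
  then show ?case by simp
qed

lemma geometric_tendsto_zero: "(\<lambda>n. 2 * (3 / 4) ^ n * K :: real) \<longlonglongrightarrow> 0"
  by (intro tendsto_mult_left_zero tendsto_mult_right_zero LIMSEQ_realpow_zero) auto

lemma fixed_map_unique:
  assumes \<phi>: "\<phi> \<in> slope_maps" "graph_transform \<phi> = \<phi>"
    and \<psi>: "\<psi> \<in> slope_maps" "graph_transform \<psi> = \<psi>"
  shows "\<phi> = \<psi>"
proof (rule extensionalityI)
  show "\<phi> \<in> extensional (center_bundle P)" "\<psi> \<in> extensional (center_bundle P)"
    using \<phi>(1) \<psi>(1) by (simp_all add: graph_maps_def)
  fix p assume "p \<in> center_bundle P"
  then obtain t \<xi> where p: "p = (t, \<xi>)" "P t \<xi> = \<xi>"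
    by (cases p) (simp add: mem_center_bundle)
  have "(graph_transform ^^ n) \<phi> = \<phi>" "(graph_transform ^^ n) \<psi> = \<psi>" for n
    by (induction n) (simp_all add: \<phi> \<psi>)
  then have "norm (\<phi> p - \<psi> p) \<le> 2 * (3 / 4) ^ n * norm \<xi>" for n
    using iterates_close[OF \<phi>(1) \<psi>(1) p(2), of n] by (simp add: p(1))
  then have "norm (\<phi> p - \<psi> p) \<le> 0"
    by (intro LIMSEQ_le_const[OF geometric_tendsto_zero]) blast
  then show "\<phi> p = \<psi> p" by simp
qed

lemma fixed_map_exists: "\<exists>\<phi> \<in> slope_maps. graph_transform \<phi> = \<phi>"
proof -
  let ?G = "center_bundle P"
  define \<phi>0 :: "real \<times> 'a \<Rightarrow> 'a" where "\<phi>0 p = (if p \<in> ?G then 0 else undefined)" for p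
  have "continuous_on ?G \<phi>0"
    by (subst continuous_on_cong[OF refl, of _ _ "\<lambda>_. 0"]) (auto simp: \<phi>0_def)
  then have \<phi>0: "\<phi>0 \<in> slope_maps"
    using slope_range
    by (auto simp: graph_maps_iff \<phi>0_def extensional_def mem_center_bundle blinfun.zero_right)
  define X where "X n = (graph_transform ^^ n) \<phi>0" for n
  have X: "X n \<in> slope_maps" for n unfolding X_def by (rule iterate_maps[OF \<phi>0])
  have near: "norm (X (n + k) (t, \<xi>) - X n (t, \<xi>)) \<le> 2 * (3 / 4) ^ n * norm \<xi>" if "P t \<xi> = \<xi>" for n k t \<xi>
    using iterates_close[OF X[of k] \<phi>0 that, of n] by (simp add: X_def funpow_add)
  have "convergent (\<lambda>n. X n (t, \<xi>))" if \<xi>: "P t \<xi> = \<xi>" for t \<xi>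
  proof (rule Cauchy_convergent, rule metric_CauchyI)
    fix e :: real assume "e > 0"
    then obtain M where M: "2 * (3 / 4) ^ M * norm \<xi> < e / 2"
      using order_tendstoD(2)[OF geometric_tendsto_zero[of "norm \<xi>"], of "e / 2"]
      by (auto simp: eventually_sequentially)
    have "dist (X n (t, \<xi>)) (X M (t, \<xi>)) < e / 2" if "n \<ge> M" for n
      using near[OF \<xi>, of M "n - M"] M that by (simp add: dist_norm)
    then show "\<exists>M. \<forall>m\<ge>M. \<forall>n\<ge>M. dist (X m (t, \<xi>)) (X n (t, \<xi>)) < e"
      by (meson dist_triangle_half_l dist_commute)
  qed
  then obtain l where l: "\<And>t \<xi>. P t \<xi> = \<xi> \<Longrightarrow> (\<lambda>n. X n (t, \<xi>)) \<longlonglongrightarrow> l t \<xi>"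
    unfolding convergent_def by metis
  define \<phi> where "\<phi> p = (if p \<in> ?G then l (fst p) (snd p) else undefined)" for p
  have lim: "(\<lambda>n. X n (t, \<xi>)) \<longlonglongrightarrow> \<phi> (t, \<xi>)" if "P t \<xi> = \<xi>" for t \<xi>
    using l[OF that] that by (simp add: \<phi>_def mem_center_bundle)
  have close: "norm (\<phi> (t, \<xi>) - X n (t, \<xi>)) \<le> 2 * (3 / 4) ^ n * norm \<xi>" if "P t \<xi> = \<xi>" for n t \<xi>
  proof (rule Lim_norm_ubound[OF sequentially_bot])
    show "(\<lambda>k. X (n + k) (t, \<xi>) - X n (t, \<xi>)) \<longlonglongrightarrow> \<phi> (t, \<xi>) - X n (t, \<xi>)"
      using LIMSEQ_ignore_initial_segment[OF lim[OF that], of n]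
      by (intro tendsto_diff tendsto_const) (simp add: add.commute)
  qed (use near[OF that] in simp)
  \<comment> \<open>Convergence is uniform only relative to \<open>\<parallel>\<xi>\<parallel>\<close>; dividing by \<open>1 + \<parallel>\<xi>\<parallel>\<close>, which has no zero,
     makes it uniform.\<close>
  have "continuous_on ?G (\<lambda>p. (1 / (1 + norm (snd p))) *\<^sub>R \<phi> p)"
  proof (rule uniform_limit_theorem)
    have ne: "1 + norm (snd p) \<noteq> 0" for p :: "real \<times> 'a"
      using norm_ge_zero[of "snd p"] by linarith
    show "eventually (\<lambda>n. continuous_on ?G (\<lambda>p. (1 / (1 + norm (snd p))) *\<^sub>R X n p)) sequentially"
      using slope_mapsD(1)[OF X] ne by (intro always_eventually allI continuous_intros) auto
    show "uniform_limit ?G (\<lambda>n p. (1 / (1 + norm (snd p))) *\<^sub>R X n p)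
        (\<lambda>p. (1 / (1 + norm (snd p))) *\<^sub>R \<phi> p) sequentially"
    proof (rule uniform_limitI)
      fix e :: real assume "e > 0"
      then have "eventually (\<lambda>n. 2 * (3 / 4) ^ n * 1 < e) sequentially"
        using order_tendstoD(2)[OF geometric_tendsto_zero[of 1]] by blast
      then show "eventually (\<lambda>n. \<forall>p\<in>?G. dist ((1 / (1 + norm (snd p))) *\<^sub>R X n p)
          ((1 / (1 + norm (snd p))) *\<^sub>R \<phi> p) < e) sequentially"
      proof (eventually_elim, intro ballI)
        fix n p assume n: "2 * (3 / 4) ^ n * 1 < e" and "p \<in> ?G"
        then obtain t \<xi> where p: "p = (t, \<xi>)" "P t \<xi> = \<xi>"
          by (cases p) (simp add: mem_center_bundle)
        have pos: "1 + norm \<xi> > 0" using norm_ge_zero[of \<xi>] by linarith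
        have "dist ((1 / (1 + norm (snd p))) *\<^sub>R X n p) ((1 / (1 + norm (snd p))) *\<^sub>R \<phi> p)
            = norm (\<phi> (t, \<xi>) - X n (t, \<xi>)) / (1 + norm \<xi>)"
          using pos by (simp add: p dist_norm norm_minus_commute flip: scaleR_diff_right)
        also have "\<dots> \<le> 2 * (3 / 4) ^ n * norm \<xi> / (1 + norm \<xi>)"
          using pos by (intro divide_right_mono close p) auto
        also have "\<dots> = 2 * (3 / 4) ^ n * (norm \<xi> / (1 + norm \<xi>))" by simp
        also have "\<dots> \<le> 2 * (3 / 4) ^ n * 1"
          using pos by (intro mult_left_mono) auto
        finally show "dist ((1 / (1 + norm (snd p))) *\<^sub>R X n p) ((1 / (1 + norm (snd p))) *\<^sub>R \<phi> p) < e"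
          using n by simp
      qed
    qed
  qed simp
  then have "continuous_on ?G (\<lambda>p. (1 + norm (snd p)) *\<^sub>R (1 / (1 + norm (snd p))) *\<^sub>R \<phi> p)"
    by (rule continuous_on_scaleR[rotated]) (intro continuous_intros)
  moreover have "(1 + norm (snd p)) *\<^sub>R (1 / (1 + norm (snd p))) *\<^sub>R \<phi> p = \<phi> p" for p
    using norm_ge_zero[of "snd p"] by (simp add: add_nonneg_eq_0_iff)
  ultimately have cont: "continuous_on ?G \<phi>" by simp
  have \<phi>: "\<phi> \<in> slope_maps"
    unfolding graph_maps_iff
  proof (intro conjI allI impI cont)
    show "\<phi> \<in> extensional ?G" by (simp add: extensional_def \<phi>_def)
    show "\<phi> (t, 0) = 0" for t
      using LIMSEQ_unique[OF lim[of t 0], of 0] slope_mapsD(2)[OF X] by (simp add: blinfun.zero_right)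
    show "P t (\<phi> (t, \<xi>)) = 0" if "P t \<xi> = \<xi>" for t \<xi>
    proof -
      have "(\<lambda>n. P t (X n (t, \<xi>))) \<longlonglongrightarrow> P t (\<phi> (t, \<xi>))"
        by (intro blinfun.tendsto tendsto_const lim that)
      then show ?thesis
        using slope_mapsD(3)[OF X that] by (simp add: LIMSEQ_const_iff)
    qed
    show "norm (\<phi> (t, \<xi>) - \<phi> (t, \<xi>')) \<le> slope * norm (\<xi> - \<xi>')"
      if "P t \<xi> = \<xi>" "P t \<xi>' = \<xi>'" for t \<xi> \<xi>'
      by (rule Lim_norm_ubound[OF sequentially_bot tendsto_diff[OF lim[OF that(1)] lim[OF that(2)]]])
        (use slope_mapsD(4)[OF X that] in simp)
  qed
  have "graph_transform \<phi> = \<phi>"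
  proof (rule extensionalityI)
    show "\<phi> \<in> extensional ?G" "graph_transform \<phi> \<in> extensional ?G"
      using \<phi> graph_transform_maps[OF \<phi>] by (simp_all add: graph_maps_def)
    fix p assume "p \<in> ?G"
    then obtain t \<xi> where p: "p = (t, \<xi>)" "P t \<xi> = \<xi>"
      by (cases p) (simp add: mem_center_bundle)
    have "norm (graph_transform \<phi> p - X (Suc n) p) \<le> 3 / 4 * (2 * (3 / 4) ^ n) * norm \<xi>" for n
      using graph_transform_contraction[OF \<phi> X[of n] _ close p(2)] by (simp add: p(1) X_def)
    then have "norm (X (Suc n) p - graph_transform \<phi> p) \<le> 2 * (3 / 4) ^ n * (3 / 4 * norm \<xi>)" for n
      by (simp add: norm_minus_commute mult_ac)
    then have "(\<lambda>n. X (Suc n) p - graph_transform \<phi> p) \<longlonglongrightarrow> 0"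
      by (intro Lim_null_comparison[OF _ geometric_tendsto_zero] always_eventually allI)
    then have "(\<lambda>n. X (Suc n) p) \<longlonglongrightarrow> graph_transform \<phi> p"
      by (simp add: Lim_null[symmetric])
    moreover have "(\<lambda>n. X (Suc n) p) \<longlonglongrightarrow> \<phi> p"
      using LIMSEQ_Suc[OF lim[OF p(2)]] by (simp add: p(1))
    ultimately show "graph_transform \<phi> p = \<phi> p" by (rule LIMSEQ_unique)
  qed
  then show ?thesis using \<phi> by blast
qed

section \<open>Fixed points and invariant graphs\<close>

abbreviation perturbed_field :: "real \<Rightarrow> 'a \<Rightarrow> 'a" where
  "perturbed_field t v \<equiv> A t v + f t v"

lemma perturbed_field_lipschitz: "norm (perturbed_field t v - perturbed_field t w) \<le> (norm (A t) + uniform_lip) * norm (v - w)"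
proof -
  have "perturbed_field t v - perturbed_field t w = A t (v - w) + (f t v - f t w)"
    by (simp add: blinfun.diff_right)
  then show ?thesis
    using norm_triangle_ineq[of "A t (v - w)" "f t v - f t w"] norm_blinfun[of "A t" "v - w"] uniform_lip[of t v w]
    by (simp add: algebra_simps)
qed

lemma continuous_rate: "continuous_on UNIV (\<lambda>t. norm (A t) + uniform_lip)"
  by (intro continuous_on_add continuous_norm_A continuous_on_const)

lemma perturbed_solution_exists: "\<exists>u. ode_solution perturbed_field u \<and> u s = v"
proof (rule ode_solution_exists[OF _ _ continuous_rate perturbed_field_lipschitz])
  have "continuous_on UNIV (\<lambda>p. A (fst p) (snd p) + (\<lambda>(t, x). f t x) p)"
    by (intro continuous_on_add continuous_f blinfun.continuous_on[OF continuous_on_compose2[OF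
            continuous_A continuous_on_fst[OF continuous_on_id]] continuous_on_snd[OF continuous_on_id]]) simp
  then show "continuous_on UNIV (\<lambda>(t, v). perturbed_field t v)" by (simp add: split_beta)
qed (auto simp: f_zero blinfun.zero_right uniform_lip_nonneg)

lemma perturbed_solution_eq:
  assumes "ode_solution perturbed_field u"
  shows "perturbed_solution A f s (u s) = u"
  unfolding perturbed_solution_def
proof (rule the_equality)
  show "w = u" if "ode_solution perturbed_field w \<and> w s = u s" for w
    by (rule ode_solution_unique[OF continuous_rate perturbed_field_lipschitz, of w u s])
      (use that assms uniform_lip_nonneg in auto)
qed (use assms in simp)

text \<open>For a fixed point, \<open>y(t) = \<phi>(t, x(t))\<close> at all times, and adding the equations of \<open>x\<close> and
  \<open>y\<close> gives the full equation.\<close>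

lemma fixed_map_solution:
  assumes \<phi>: "\<phi> \<in> slope_maps" "graph_transform \<phi> = \<phi>" and \<xi>: "P s \<xi> = \<xi>"
  obtains x where "center_trajectory \<phi> x" "x s = \<xi>"
    and "\<And>t. Psi A f (t - s) (graph_point \<phi> s \<xi>) = graph_point \<phi> t (x t)"
proof -
  obtain x y where x: "center_trajectory \<phi> x" "x s = \<xi>" and y: "fibre_response (forcing \<phi> x) y"
    using lifted_trajectory_exists[OF \<phi>(1) \<xi>] .
  have y_eq: "y t = \<phi> (t, x t)" for t
    using graph_transform_eq[OF \<phi>(1) x(1) y, of t] by (simp add: \<phi>(2))
  define u where "u t = x t + \<phi> (t, x t)" for t
  have "(u has_vector_derivative perturbed_field t (u t)) (at t)" for t
  proof (rule moving_frame_solution)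
    have "((\<lambda>t. T 0 t (x t) + T 0 t (y t)) has_vector_derivative
        P 0 (T 0 t (forcing \<phi> x t)) + (T 0 t (forcing \<phi> x t) - P 0 (T 0 t (forcing \<phi> x t)))) (at t)"
      using x(1) y unfolding center_trajectory_def fibre_response_def
      by (intro has_vector_derivative_add) auto
    then show "((\<lambda>t. T 0 t (u t)) has_vector_derivative T 0 t (f t (u t))) (at t)"
      by (simp add: u_def y_eq forcing_def blinfun.add_right)
  qed
  then have "ode_solution perturbed_field u" by (simp add: ode_solution_def)
  then have "perturbed_solution A f s (u s) = u" by (rule perturbed_solution_eq)
  moreover have "u s = \<xi> + \<phi> (s, \<xi>)" by (simp add: u_def x)
  ultimately have "Psi A f (t - s) (graph_point \<phi> s \<xi>) = graph_point \<phi> t (x t)" for t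
    by (simp add: Psi_def graph_point_def u_def)
  then show thesis using that x by blast
qed

lemma fixed_map_invariant:
  assumes \<phi>: "\<phi> \<in> slope_maps" "graph_transform \<phi> = \<phi>"
  shows "Psi A f \<tau> ` bundle_graph P \<phi> \<subseteq> bundle_graph P \<phi>"
proof (rule image_subsetI)
  fix p assume "p \<in> bundle_graph P \<phi>"
  then obtain s \<xi> where p: "p = graph_point \<phi> s \<xi>" and \<xi>: "P s \<xi> = \<xi>"
    unfolding bundle_graph_def mem_center_bundle by auto
  obtain x where x: "center_trajectory \<phi> x"
    and Psi: "\<And>t. Psi A f (t - s) (graph_point \<phi> s \<xi>) = graph_point \<phi> t (x t)"
    using fixed_map_solution[OF \<phi> \<xi>] by metis
  have "Psi A f \<tau> p = graph_point \<phi> (s + \<tau>) (x (s + \<tau>))"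
    using Psi[of "s + \<tau>"] by (simp add: p)
  then show "Psi A f \<tau> p \<in> bundle_graph P \<phi>"
    using center_trajectory_mem[OF x] unfolding bundle_graph_def mem_center_bundle by blast
qed

lemma fixed_map_growth:
  assumes \<phi>: "\<phi> \<in> slope_maps" "graph_transform \<phi> = \<phi>" and \<xi>: "P s \<xi> = \<xi>" "P s \<xi>' = \<xi>'"
  shows "norm (snd (Psi A f (t - s) (graph_point \<phi> s \<xi>)) - snd (Psi A f (t - s) (graph_point \<phi> s \<xi>')))
    \<le> 3 * \<alpha> t s * norm (\<xi> - \<xi>')"
proof -
  obtain x where x: "center_trajectory \<phi> x" "x s = \<xi>"
    and Psi: "\<And>t. Psi A f (t - s) (graph_point \<phi> s \<xi>) = graph_point \<phi> t (x t)"
    using fixed_map_solution[OF \<phi> \<xi>(1)] by metis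
  obtain x' where x': "center_trajectory \<phi> x'" "x' s = \<xi>'"
    and Psi': "\<And>t. Psi A f (t - s) (graph_point \<phi> s \<xi>') = graph_point \<phi> t (x' t)"
    using fixed_map_solution[OF \<phi> \<xi>(2)] by metis
  have "norm ((x t + \<phi> (t, x t)) - (x' t + \<phi> (t, x' t)))
      \<le> 2 * norm (x t - x' t) + norm (\<phi> (t, x' t) - \<phi> (t, x' t))"
    by (intro forcing_diff(1)[OF \<phi>(1)] center_trajectory_mem[OF x(1)] center_trajectory_mem[OF x'(1)])
  also have "\<dots> \<le> 2 * (3 / 2 * norm (x s - x' s) * \<alpha> t s)"
    using center_trajectory_lipschitz[OF \<phi>(1) x(1) x'(1), of t s] by simp
  finally show ?thesis
    unfolding Psi Psi' unfolding graph_point_def by (simp add: x x' mult_ac)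
qed

text \<open>Here the full gap \<open>c + d + \<epsilon> < 0\<close> is used: \<open>\<beta>\<^sup>+\<^sub>0\<^sub>,\<^sub>t\<close> carries the factor \<open>e\<^bsup>\<epsilon>\<bar>t\<bar>\<^esup>\<close>.\<close>

lemma stable_decay: "((\<lambda>t. \<beta>p 0 t * (K * \<alpha> t s)) \<longlongrightarrow> 0) at_bot"
proof -
  let ?C = "D * D * K * exp (c * s + \<epsilon> * \<bar>s\<bar>)"
  have "filterlim (\<lambda>t. - (c + d + \<epsilon>) * t) at_bot at_bot"
    using gap_cd by (intro filterlim_tendsto_pos_mult_at_bot[OF tendsto_const] filterlim_ident) auto
  then have lim: "((\<lambda>t. ?C * exp (- (c + d + \<epsilon>) * t)) \<longlongrightarrow> ?C * 0) at_bot"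
    by (intro tendsto_mult tendsto_const filterlim_compose[OF exp_at_bot])
  have eq: "eventually (\<lambda>t. ?C * exp (- (c + d + \<epsilon>) * t) = \<beta>p 0 t * (K * \<alpha> t s)) at_bot"
    using eventually_le_at_bot[of "min 0 s"]
    by eventually_elim (simp add: exp_beta_plus_def alpha_le algebra_simps flip: exp_add)
  show ?thesis using Lim_transform_eventually[OF lim eq] by simp
qed

lemma unstable_decay: "((\<lambda>t. \<beta>m 0 t * (K * \<alpha> t s)) \<longlongrightarrow> 0) at_top"
proof -
  let ?C = "D * D * K * exp (\<epsilon> * \<bar>s\<bar> - a * s)"
  have "filterlim (\<lambda>t. (a + b + \<epsilon>) * t) at_bot at_top"
    using gap_ab by (intro filterlim_tendsto_neg_mult_at_bot[OF tendsto_const] filterlim_ident) auto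
  then have lim: "((\<lambda>t. ?C * exp ((a + b + \<epsilon>) * t)) \<longlongrightarrow> ?C * 0) at_top"
    by (intro tendsto_mult tendsto_const filterlim_compose[OF exp_at_bot])
  have eq: "eventually (\<lambda>t. ?C * exp ((a + b + \<epsilon>) * t) = \<beta>m 0 t * (K * \<alpha> t s)) at_top"
    using eventually_ge_at_top[of "max 0 s"]
    by eventually_elim (simp add: exp_beta_minus_def alpha_ge algebra_simps flip: exp_add)
  show ?thesis using Lim_transform_eventually[OF lim eq] by simp
qed

text \<open>Split a solution \<open>u\<close> on the graph into \<open>x = P u\<close> and \<open>y = \<phi>(\<sqdot>, x)\<close>. Then \<open>x\<close> is a center
  trajectory, so it grows at most like \<open>\<alpha>\<close>, and so does \<open>y\<close>; the gaps make the stable part of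
  \<open>y\<close> forget \<open>-\<infinity>\<close> and the unstable part forget \<open>+\<infinity>\<close>. Hence \<open>y\<close> is the response to \<open>x\<close>.\<close>

lemma invariant_map_fixed:
  assumes \<phi>: "\<phi> \<in> slope_maps"
    and inv: "\<And>\<tau>. Psi A f \<tau> ` bundle_graph P \<phi> \<subseteq> bundle_graph P \<phi>"
  shows "graph_transform \<phi> = \<phi>"
proof (rule extensionalityI)
  show "\<phi> \<in> extensional (center_bundle P)" "graph_transform \<phi> \<in> extensional (center_bundle P)"
    using \<phi> graph_transform_maps[OF \<phi>] by (simp_all add: graph_maps_def)
  fix p assume "p \<in> center_bundle P"
  then obtain s \<xi> where p: "p = (s, \<xi>)" "P s \<xi> = \<xi>"
    by (cases p) (simp add: mem_center_bundle)
  obtain u where u: "ode_solution perturbed_field u" "u s = \<xi> + \<phi> (s, \<xi>)"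
    using perturbed_solution_exists by blast
  define x where "x t = P t (u t)" for t
  define y where "y t = \<phi> (t, x t)" for t
  have Px: "P t (x t) = x t" for t by (simp add: x_def)
  have u_eq: "u t = x t + y t" for t
  proof -
    have "graph_point \<phi> s \<xi> \<in> bundle_graph P \<phi>"
      using p(2) unfolding bundle_graph_def mem_center_bundle by blast
    then have "Psi A f (t - s) (graph_point \<phi> s \<xi>) \<in> bundle_graph P \<phi>"
      using inv by blast
    moreover have "Psi A f (t - s) (graph_point \<phi> s \<xi>) = (t, u t)"
      using perturbed_solution_eq[OF u(1), of s] by (simp add: Psi_def graph_point_def u(2))
    ultimately obtain \<eta> where \<eta>: "P t \<eta> = \<eta>" "u t = \<eta> + \<phi> (t, \<eta>)"
      unfolding bundle_graph_def mem_center_bundle graph_point_def by auto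
    then have "x t = \<eta>"
      using slope_mapsD(3)[OF \<phi> \<eta>(1)] by (simp add: x_def blinfun.add_right)
    then show ?thesis using \<eta>(2) by (simp add: y_def)
  qed
  have forcing: "forcing \<phi> x t = f t (u t)" for t
    by (simp add: forcing_def u_eq y_def)
  have du: "((\<lambda>t. T 0 t (u t)) has_vector_derivative T 0 t (f t (u t))) (at t)" for t
    using u(1) by (intro moving_frame_derivative) (simp add: ode_solution_def)
  have dPu: "((\<lambda>t. P 0 (T 0 t (u t))) has_vector_derivative P 0 (T 0 t (f t (u t)))) (at t)" for t
    by (rule bounded_linear.has_vector_derivative[OF blinfun.bounded_linear_right du])
  have Tx: "T 0 t (x t) = P 0 (T 0 t (u t))" for t by (simp add: x_def P_T)
  have Ty: "T 0 t (y t) = T 0 t (u t) - P 0 (T 0 t (u t))" for t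
    using u_eq[of t] Tx[of t] by (simp add: blinfun.add_right flip: Tx)
  have x: "center_trajectory \<phi> x"
    unfolding center_trajectory_def Tx forcing using Px dPu by blast
  have "\<xi> = x s"
    using p(2) slope_mapsD(3)[OF \<phi> p(2)] by (simp add: x_def u(2) blinfun.add_right)
  have y_le: "norm (y t) \<le> 3 / 2 * norm (x s) * \<alpha> t s" for t
  proof -
    have "norm (y t) \<le> 1 * norm (x t)"
      unfolding y_def using slope_range
      by (intro order_trans[OF slope_mapsD(5)[OF \<phi> Px]] mult_right_mono) auto
    then show ?thesis using center_trajectory_norm[OF \<phi> x, of t s] by simp
  qed
  have y: "fibre_response (forcing \<phi> x) y"
    unfolding fibre_response_def
  proof (intro conjI allI)
    show "P t (y t) = 0" for t unfolding y_def by (rule slope_mapsD(3)[OF \<phi> Px])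
    show "((\<lambda>t. T 0 t (y t)) has_vector_derivative
        T 0 t (forcing \<phi> x t) - P 0 (T 0 t (forcing \<phi> x t))) (at t)" for t
      unfolding Ty forcing by (rule has_vector_derivative_diff[OF du dPu])
    show "((\<lambda>t. Qp 0 (T 0 t (y t))) \<longlongrightarrow> 0) at_bot"
    proof (rule Lim_null_comparison[OF _ stable_decay])
      show "eventually (\<lambda>t. norm (Qp 0 (T 0 t (y t))) \<le> \<beta>p 0 t * (3 / 2 * norm (x s) * \<alpha> t s)) at_bot"
        using eventually_le_at_bot[of 0]
      proof eventually_elim
        case (elim t)
        have "Qp 0 (T 0 t (y t)) = (T 0 t o\<^sub>L Qp t) (y t)" by (simp add: Qp_T)
        also have "norm \<dots> \<le> \<beta>p 0 t * (3 / 2 * norm (x s) * \<alpha> t s)"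
          by (rule order_trans[OF norm_blinfun mult_mono[OF norm_T_Qp[OF elim] y_le
                order_trans[OF norm_ge_zero norm_T_Qp[OF elim]] norm_ge_zero]])
        finally show ?case .
      qed
    qed
    show "((\<lambda>t. Qm 0 (T 0 t (y t))) \<longlongrightarrow> 0) at_top"
    proof (rule Lim_null_comparison[OF _ unstable_decay])
      show "eventually (\<lambda>t. norm (Qm 0 (T 0 t (y t))) \<le> \<beta>m 0 t * (3 / 2 * norm (x s) * \<alpha> t s)) at_top"
        using eventually_ge_at_top[of 0]
      proof eventually_elim
        case (elim t)
        have "Qm 0 (T 0 t (y t)) = (T 0 t o\<^sub>L Qm t) (y t)" by (simp add: Qm_T)
        also have "norm \<dots> \<le> \<beta>m 0 t * (3 / 2 * norm (x s) * \<alpha> t s)"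
          by (rule order_trans[OF norm_blinfun mult_mono[OF norm_T_Qm[OF elim] y_le
                order_trans[OF norm_ge_zero norm_T_Qm[OF elim]] norm_ge_zero]])
        finally show ?case .
      qed
    qed
  qed
  show "graph_transform \<phi> p = \<phi> p"
    using graph_transform_eq[OF \<phi> x y, of s] by (simp add: p(1) y_def flip: \<open>\<xi> = x s\<close>)
qed

section \<open>The constant \<open>\<omega>\<close> and the center manifold\<close>

text \<open>The majorant bounds \<open>Lip(f\<^sub>r)\<close> for \<open>r \<noteq> 0\<close>; the remaining time is a null set.\<close>

lemma omega_le: "omega \<alpha> \<beta>p \<beta>m f \<le> ennreal (2 * \<delta>)"
  unfolding omega_def
proof (rule SUP_least)
  fix s
  have nz: "AE r in lborel. r \<noteq> (0 :: real)" by (rule AE_lborel_singleton)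
  have half_lines: "{..s} = (\<Union>n. {s - real n..s})" "{s..} = (\<Union>n. {s..s + real n})"
  proof -
    show "{..s} = (\<Union>n. {s - real n..s})"
    proof (intro equalityI subsetI)
      fix r assume "r \<in> {..s}"
      moreover obtain n where "s - r \<le> real n" using real_arch_simple by blast
      ultimately show "r \<in> (\<Union>n. {s - real n..s})" by (auto intro!: exI[of _ n])
    qed auto
    show "{s..} = (\<Union>n. {s..s + real n})"
    proof (intro equalityI subsetI)
      fix r assume "r \<in> {s..}"
      moreover obtain n where "r - s \<le> real n" using real_arch_simple by blast
      ultimately show "r \<in> (\<Union>n. {s..s + real n})" by (auto intro!: exI[of _ n])
    qed auto
  qed
  have meas: "plus_density s \<in> borel_measurable borel" "minus_density s \<in> borel_measurable borel"
    unfolding plus_density_def[abs_def] minus_density_def[abs_def] by measurable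
  have "(\<integral>\<^sup>+ r \<in> {..s}. ennreal (\<beta>p s r) * Lip (f r) * ennreal (\<alpha> r s) \<partial>lborel)
      \<le> (\<integral>\<^sup>+ r \<in> {..s}. ennreal (plus_density s r) \<partial>lborel)"
  proof (rule nn_integral_mono_AE)
    show "AE r in lborel. ennreal (\<beta>p s r) * Lip (f r) * ennreal (\<alpha> r s) * indicator {..s} r
        \<le> ennreal (plus_density s r) * indicator {..s} r"
      using nz
    proof eventually_elim
      case (elim r)
      show ?case
      proof (cases "r \<le> s")
        case True
        have "ennreal (\<beta>p s r) * Lip (f r) * ennreal (\<alpha> r s) \<le> ennreal (\<beta>p s r) * ennreal (lip r) * ennreal (\<alpha> r s)"
          by (intro mult_mono Lip_le_lip elim) auto
        also have "\<dots> = ennreal (\<beta>p s r * lip r * \<alpha> r s)"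
          using D lip_nonneg[of r] alpha_pos[of r s] by (simp add: ennreal_mult exp_beta_plus_def)
        also have "\<dots> \<le> ennreal (plus_density s r)"
          by (intro ennreal_leI plus_density_bound True)
        finally show ?thesis using True by simp
      qed simp
    qed
  qed
  also have "\<dots> \<le> ennreal \<delta>"
    unfolding half_lines
    by (rule nn_integral_le_increment[where F = "plus_primitive s"])
      (use primitives_sign(1)[of s] in \<open>auto intro!: continuous_primitives plus_primitive_derivative
        densities_nonneg meas simp: incseq_def\<close>)
  finally have p: "(\<integral>\<^sup>+ r \<in> {..s}. ennreal (\<beta>p s r) * Lip (f r) * ennreal (\<alpha> r s) \<partial>lborel) \<le> ennreal \<delta>" .
  have "(\<integral>\<^sup>+ r \<in> {s..}. ennreal (\<beta>m s r) * Lip (f r) * ennreal (\<alpha> r s) \<partial>lborel)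
      \<le> (\<integral>\<^sup>+ r \<in> {s..}. ennreal (minus_density s r) \<partial>lborel)"
  proof (rule nn_integral_mono_AE)
    show "AE r in lborel. ennreal (\<beta>m s r) * Lip (f r) * ennreal (\<alpha> r s) * indicator {s..} r
        \<le> ennreal (minus_density s r) * indicator {s..} r"
      using nz
    proof eventually_elim
      case (elim r)
      show ?case
      proof (cases "s \<le> r")
        case True
        have "ennreal (\<beta>m s r) * Lip (f r) * ennreal (\<alpha> r s) \<le> ennreal (\<beta>m s r) * ennreal (lip r) * ennreal (\<alpha> r s)"
          by (intro mult_mono Lip_le_lip elim) auto
        also have "\<dots> = ennreal (\<beta>m s r * lip r * \<alpha> r s)"
          using D lip_nonneg[of r] alpha_pos[of r s] by (simp add: ennreal_mult exp_beta_minus_def)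
        also have "\<dots> \<le> ennreal (minus_density s r)"
          by (intro ennreal_leI minus_density_bound True)
        finally show ?thesis using True by simp
      qed simp
    qed
  qed
  also have "\<dots> \<le> ennreal \<delta>"
    unfolding half_lines
    by (rule nn_integral_le_increment[where F = "minus_primitive s"])
      (use primitives_sign(2)[of s] in \<open>auto intro!: continuous_primitives minus_primitive_derivative
        densities_nonneg meas simp: incseq_def\<close>)
  finally have m: "(\<integral>\<^sup>+ r \<in> {s..}. ennreal (\<beta>m s r) * Lip (f r) * ennreal (\<alpha> r s) \<partial>lborel) \<le> ennreal \<delta>" .
  show "(\<integral>\<^sup>+ r \<in> {..s}. ennreal (\<beta>p s r) * Lip (f r) * ennreal (\<alpha> r s) \<partial>lborel)
      + (\<integral>\<^sup>+ r \<in> {s..}. ennreal (\<beta>m s r) * Lip (f r) * ennreal (\<alpha> r s) \<partial>lborel) \<le> ennreal (2 * \<delta>)"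
    using add_mono[OF p m] delta_nonneg by (simp flip: ennreal_plus)
qed

end

theorem corollary4p4:
  fixes A :: "real \<Rightarrow> 'a::banach \<Rightarrow>\<^sub>L 'a"
    and T :: "real \<Rightarrow> real \<Rightarrow> 'a \<Rightarrow>\<^sub>L 'a"
    and P Qp Qm :: "real \<Rightarrow> 'a \<Rightarrow>\<^sub>L 'a"
    and f :: "real \<Rightarrow> 'a \<Rightarrow> 'a"
    and a b c d D \<epsilon> \<delta> \<gamma> :: real
    and \<omega> :: ennreal
  defines "\<omega> \<equiv> omega (exp_alpha D a c \<epsilon>) (exp_beta_plus D d \<epsilon>) (exp_beta_minus D b \<epsilon>) f"
  assumes "continuous_on UNIV A"
    and "evolution_operator A T"
    and "D \<ge> 1" and "\<epsilon> \<ge> 0"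
    and "nonuniform_exp_trichotomy T P Qp Qm a b c d D \<epsilon>"
    and "continuous_on UNIV (\<lambda>(t, x). f t x)"
    and "\<And>t. f t 0 = 0"
    and "\<And>t. Lip (f t) < \<infinity>"
    and "\<And>r. r \<noteq> 0 \<Longrightarrow> enn2real (Lip (f r)) \<le> \<delta> / (D\<^sup>2 * exp (2 * \<epsilon> * \<bar>r\<bar>)) *
           Min {- c - d - \<epsilon> * sgn r, - a - b + \<epsilon> * sgn r, D * \<gamma> / 2 * exp ((\<epsilon> - \<gamma>) * \<bar>r\<bar>)}"
    and "\<delta> < 1 / 6"
    and "\<epsilon> > 0 \<Longrightarrow> \<gamma> = \<epsilon>"
    and "\<epsilon> = 0 \<Longrightarrow> 0 < \<gamma> \<and> \<gamma> < 2 / D * min (- c - d) (- a - b)"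
    and "\<omega> > 0"
    and "a + b + \<epsilon> < 0" and "c + d + \<epsilon> < 0"
  shows "\<exists>N. 0 < N \<and> N < 1 \<and>
    (\<exists>!\<phi>. \<phi> \<in> graph_maps P Qp Qm N \<and>
      (\<forall>\<tau>. Psi A f \<tau> ` bundle_graph P \<phi> \<subseteq> bundle_graph P \<phi>) \<and>
      (\<forall>t s \<xi> \<xi>'. (s, \<xi>) \<in> center_bundle P \<longrightarrow> (s, \<xi>') \<in> center_bundle P \<longrightarrow>
        norm (snd (Psi A f (t - s) (graph_point \<phi> s \<xi>)) - snd (Psi A f (t - s) (graph_point \<phi> s \<xi>')))
        \<le> (if t \<ge> s
            then D * N / enn2real \<omega> * exp (a * (t - s) + \<epsilon> * \<bar>s\<bar>) * norm (\<xi> - \<xi>')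
            else D * N / enn2real \<omega> * exp (c * (s - t) + \<epsilon> * \<bar>s\<bar>) * norm (\<xi> - \<xi>'))))"
proof -
  have "\<gamma> > 0"
    using assms(5,12,13) by (cases "\<epsilon> = 0") auto
  then interpret trichotomy_problem A T P Qp Qm f a b c d D \<epsilon> \<delta> \<gamma>
    by unfold_locales (use assms in blast)+
  have "\<omega> \<le> ennreal (2 * \<delta>)" unfolding \<omega>_def by (rule omega_le)
  then have pos: "0 < enn2real \<omega>" and le: "enn2real \<omega> \<le> 2 * \<delta>"
    using \<open>\<omega> > 0\<close> delta_nonneg
    by (auto simp: enn2real_positive_iff enn2real_leI less_top[symmetric] top_unique)
  then have "\<delta> > 0" by linarith
  \<comment> \<open>Points of the invariant graph separate at rate \<open>3 \<alpha>\<close>, and \<open>\<omega> \<le> 2\<delta>\<close> makes \<open>N/\<omega>\<close> at least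
     \<open>6\<delta> / 2\<delta> = 3\<close>.\<close>
  have "3 \<le> slope / enn2real \<omega>"
    using pos le by (simp add: le_divide_eq)
  then have bound: "3 * \<alpha> t s * k \<le> (if t \<ge> s
      then D * slope / enn2real \<omega> * exp (a * (t - s) + \<epsilon> * \<bar>s\<bar>) * k
      else D * slope / enn2real \<omega> * exp (c * (s - t) + \<epsilon> * \<bar>s\<bar>) * k)" if "k \<ge> 0" for t s k
  proof -
    have "3 * (\<alpha> t s * k) \<le> slope / enn2real \<omega> * (\<alpha> t s * k)"
      using \<open>3 \<le> slope / enn2real \<omega>\<close> that alpha_pos[of t s] by (intro mult_right_mono) auto
    also have "\<dots> = (if t \<ge> s
      then D * slope / enn2real \<omega> * exp (a * (t - s) + \<epsilon> * \<bar>s\<bar>) * k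
      else D * slope / enn2real \<omega> * exp (c * (s - t) + \<epsilon> * \<bar>s\<bar>) * k)"
      by (simp add: exp_alpha_def)
    finally show ?thesis by (simp only: mult.assoc)
  qed
  obtain \<phi> where \<phi>: "\<phi> \<in> slope_maps" "graph_transform \<phi> = \<phi>"
    using fixed_map_exists by blast
  show ?thesis
  proof (intro exI[of _ slope] conjI ex1I[of _ \<phi>])
    show "0 < slope" "slope < 1" using \<open>\<delta> > 0\<close> delta by auto
    show "\<phi> \<in> slope_maps" by (rule \<phi>)
    show "\<forall>\<tau>. Psi A f \<tau> ` bundle_graph P \<phi> \<subseteq> bundle_graph P \<phi>"
      using fixed_map_invariant[OF \<phi>] by blast
    show "\<forall>t s \<xi> \<xi>'. (s, \<xi>) \<in> center_bundle P \<longrightarrow> (s, \<xi>') \<in> center_bundle P \<longrightarrow>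
        norm (snd (Psi A f (t - s) (graph_point \<phi> s \<xi>)) - snd (Psi A f (t - s) (graph_point \<phi> s \<xi>')))
        \<le> (if t \<ge> s
            then D * slope / enn2real \<omega> * exp (a * (t - s) + \<epsilon> * \<bar>s\<bar>) * norm (\<xi> - \<xi>')
            else D * slope / enn2real \<omega> * exp (c * (s - t) + \<epsilon> * \<bar>s\<bar>) * norm (\<xi> - \<xi>'))"
      unfolding mem_center_bundle
      by (intro allI impI order_trans[OF fixed_map_growth[OF \<phi>] bound] norm_ge_zero)
  next
    fix \<psi>
    assume "\<psi> \<in> slope_maps \<and> (\<forall>\<tau>. Psi A f \<tau> ` bundle_graph P \<psi> \<subseteq> bundle_graph P \<psi>) \<and>
      (\<forall>t s \<xi> \<xi>'. (s, \<xi>) \<in> center_bundle P \<longrightarrow> (s, \<xi>') \<in> center_bundle P \<longrightarrow>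
        norm (snd (Psi A f (t - s) (graph_point \<psi> s \<xi>)) - snd (Psi A f (t - s) (graph_point \<psi> s \<xi>')))
        \<le> (if t \<ge> s
            then D * slope / enn2real \<omega> * exp (a * (t - s) + \<epsilon> * \<bar>s\<bar>) * norm (\<xi> - \<xi>')
            else D * slope / enn2real \<omega> * exp (c * (s - t) + \<epsilon> * \<bar>s\<bar>) * norm (\<xi> - \<xi>')))"
    then have \<psi>: "\<psi> \<in> slope_maps" "\<And>\<tau>. Psi A f \<tau> ` bundle_graph P \<psi> \<subseteq> bundle_graph P \<psi>"
      by blast+
    show "\<psi> = \<phi>"
      by (rule fixed_map_unique[OF \<psi>(1) invariant_map_fixed[OF \<psi>] \<phi>])
  qed
qed

end
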